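(* Let $\Bbbk$ be a field, let $M\subset R=\Bbbk[x_1,\ldots,x_d]$ and $N\subset S=\Bbbk[y_1,\ldots,y_t]$ be monomial ideals, and suppose that their Betti posets are isomorphic as posets, via an isomorphism $g:B_M\to B_N$. Then a minimal $\mathbb{Z}^d$-graded free resolution of $R/M$ can be relabeled (along $g$) to give the minimal $\mathbb{Z}^t$-graded free resolution of $S/N$.
   Context: The lcm-lattice $L_M$ of a monomial ideal $M$ is the set of all least common multiples of subsets of the minimal monomial generators of $M$, ordered by divisibility, with minimal element $\hat 0=1$. For $p\in L_M$ let $\Delta_p$ be the order complex of the open interval $(\hat 0,p)\subset L_M$; the order complex of an empty poset is $\{\varnothing\}$, whose reduced homology is $\Bbbk$ in degree $-1$. The Betti poset of $M$ (over $\Bbbk$) is the subposet $B_M=\{p\in L_M:\widetilde H_i(\Delta_p,\Bbbk)\ne 0\text{ for some } i\}$; it contains $\hat 0=1$. All multidegrees of basis elements in a minimal $\mathbb Z^d$-graded free resolution of $R/M$ are (exponents of) elements of $B_M$. Relabeling along $g$: let $(\mathcal F_M,\partial^M)$ be a minimal $\mathbb{Z}^d$-graded free resolution of $R/M$ with a chosen homogeneous basis, so that for each basis element $e$ of multidegree $\mathbf a$ one has $\partial^M(e)=\sum_{e'} c_{e,e'}\frac{\mathbf{x}^{\mathbf a}}{\mathbf{x}^{\mathbf a'}}\,e'$, where $e'$ runs over the basis elements in the next lower homological degree, $\mathbf a'$ is the multidegree of $e'$, $c_{e,e'}\in\Bbbk$, and $c_{e,e'}=0$ unless $\mathbf{x}^{\mathbf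 a'}$ divides $\mathbf{x}^{\mathbf a}$. The relabeled sequence $\mathcal F_N$ of free $S$-modules has, for each basis element $e$ of $\mathcal F_M$ of multidegree $\mathbf a$, a basis element $\tilde e$ in the same homological degree whose multidegree is that of the monomial $g(\mathbf x^{\mathbf a})$, and has maps $\partial^N(\tilde e)=\sum_{e'} c_{e,e'}\frac{g(\mathbf{x}^{\mathbf a})}{g(\mathbf{x}^{\mathbf a'})}\,\tilde e'$. The assertion is that $(\mathcal F_N,\partial^N)$ is a minimal free resolution of $S/N$.
   Formalization: It is additionally assumed that M is the unit ideal if and only if N is; otherwise M = R and N = 0 have the same Betti poset {1} although R/M = 0 and S/N = S have different resolutions. *)

theory Defs
  imports Complex_Main "HOL-Library.Poly_Mapping"
begin

section \<open>Monomials and monomial ideals\<close>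

text \<open>
  The polynomial ring over a field \<open>'k\<close> in the variables indexed by a finite type \<open>'x\<close>
  is the monoid algebra \<open>('x \<Rightarrow>\<^sub>0 nat) \<Rightarrow>\<^sub>0 'k\<close>. A monomial is represented by its exponent
  vector, so products of monomials are sums of exponents and the monomial 1 is \<open>0\<close>.
\<close>

type_synonym 'x mono = "'x \<Rightarrow>\<^sub>0 nat"
type_synonym ('x, 'k) mpoly = "('x \<Rightarrow>\<^sub>0 nat) \<Rightarrow>\<^sub>0 'k"

definition monom_poly :: "'x mono \<Rightarrow> ('x, 'k::field) mpoly" where
  "monom_poly m = Poly_Mapping.single m 1"

definition mono_dvd :: "'x mono \<Rightarrow> 'x mono \<Rightarrow> bool" where
  "mono_dvd m n \<longleftrightarrow> (\<forall>x. Poly_Mapping.lookup m x \<le> Poly_Mapping.lookup n x)"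

definition mono_sdvd :: "'x mono \<Rightarrow> 'x mono \<Rightarrow> bool" where
  "mono_sdvd m n \<longleftrightarrow> mono_dvd m n \<and> m \<noteq> n"

definition mono_lcm :: "'x::finite mono set \<Rightarrow> 'x mono" where
  "mono_lcm A =
     Poly_Mapping.Abs_poly_mapping (\<lambda>x. Max (insert 0 ((\<lambda>m. Poly_Mapping.lookup m x) ` A)))"

definition ideal_gen :: "('x, 'k::field) mpoly set \<Rightarrow> ('x, 'k) mpoly set" where
  "ideal_gen = module.span (*)"

definition monomial_ideal :: "('x, 'k::field) mpoly set \<Rightarrow> bool" where
  "monomial_ideal M \<longleftrightarrow> (\<exists>A. M = ideal_gen (monom_poly ` A))"

definition min_gens :: "('x, 'k::field) mpoly set \<Rightarrow> 'x mono set" where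
  "min_gens M = {m. monom_poly m \<in> M \<and> (\<forall>n. monom_poly n \<in> M \<and> mono_dvd n m \<longrightarrow> n = m)}"

text \<open>The ideal generated by the variables.\<close>

definition irrelevant_ideal :: "('x, 'k::field) mpoly set" where
  "irrelevant_ideal = ideal_gen (range (\<lambda>x. monom_poly (Poly_Mapping.single x 1)))"

section \<open>Quotients\<close>

definition coset :: "'a::ab_group_add set \<Rightarrow> 'a \<Rightarrow> 'a set" where
  "coset B z = (\<lambda>b. z + b) ` B"

definition quot :: "'a::ab_group_add set \<Rightarrow> 'a set \<Rightarrow> 'a set set" where
  "quot Z B = coset B ` Z"

section \<open>Order complexes and reduced simplicial homology\<close>

definition order_complex :: "('a \<Rightarrow> 'a \<Rightarrow> bool) \<Rightarrow> 'a set \<Rightarrow> 'a set set" where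
  "order_complex le P = {\<sigma>. finite \<sigma> \<and> \<sigma> \<subseteq> P \<and> (\<forall>a\<in>\<sigma>. \<forall>b\<in>\<sigma>. le a b \<or> le b a)}"

text \<open>
  The simplicial complex \<open>K\<close> contains the empty face, which has dimension \<open>-1\<close>. The strict
  relation \<open>lt\<close> on vertices is meant to be a linear order on every face; it fixes the
  orientations, and hence the signs in the boundary map.
\<close>

definition simplicial_chains :: "'a set set \<Rightarrow> int \<Rightarrow> ('a set \<Rightarrow>\<^sub>0 'k::field) set" where
  "simplicial_chains K i = {c. Poly_Mapping.keys c \<subseteq> {\<sigma>\<in>K. int (card \<sigma>) = i + 1}}"

definition simplicial_boundary ::
    "('a \<Rightarrow> 'a \<Rightarrow> bool) \<Rightarrow> ('a set \<Rightarrow>\<^sub>0 'k::field) \<Rightarrow> ('a set \<Rightarrow>\<^sub>0 'k)" where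
  "simplicial_boundary lt c =
     (\<Sum>\<sigma>\<in>Poly_Mapping.keys c. \<Sum>v\<in>\<sigma>.
        Poly_Mapping.single (\<sigma> - {v}) ((-1) ^ card {u\<in>\<sigma>. lt u v} * Poly_Mapping.lookup c \<sigma>))"

definition simplicial_cycles ::
    "('a \<Rightarrow> 'a \<Rightarrow> bool) \<Rightarrow> 'a set set \<Rightarrow> int \<Rightarrow> ('a set \<Rightarrow>\<^sub>0 'k::field) set" where
  "simplicial_cycles lt K i = {c \<in> simplicial_chains K i. simplicial_boundary lt c = 0}"

definition simplicial_boundaries ::
    "('a \<Rightarrow> 'a \<Rightarrow> bool) \<Rightarrow> 'a set set \<Rightarrow> int \<Rightarrow> ('a set \<Rightarrow>\<^sub>0 'k::field) set" where
  "simplicial_boundaries lt K i = simplicial_boundary lt ` simplicial_chains K (i + 1)"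

definition reduced_homology ::
    "('a \<Rightarrow> 'a \<Rightarrow> bool) \<Rightarrow> 'a set set \<Rightarrow> int \<Rightarrow> ('a set \<Rightarrow>\<^sub>0 'k::field) set set" where
  "reduced_homology lt K i = quot (simplicial_cycles lt K i) (simplicial_boundaries lt K i)"

section \<open>The lcm-lattice and the Betti poset\<close>

definition lcm_lattice :: "('x::finite, 'k::field) mpoly set \<Rightarrow> 'x mono set" where
  "lcm_lattice M = {mono_lcm A | A. A \<subseteq> min_gens M}"

definition lower_complex :: "('x::finite, 'k::field) mpoly set \<Rightarrow> 'x mono \<Rightarrow> 'x mono set set" where
  "lower_complex M p =
     order_complex mono_dvd {q \<in> lcm_lattice M. mono_sdvd 0 q \<and> mono_sdvd q p}"

text \<open>
  A quotient is nonzero iff it differs from the set consisting of the zero coset only. The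
  type annotation makes the coefficients of the homology the field of coefficients of \<open>M\<close>.
  The zero ideal and the unit ideal both have Betti poset \<open>{0}\<close>, i.e. only the monomial 1, although
  their quotients have different resolutions.
\<close>

definition betti_poset :: "('x::finite, 'k::field) mpoly set \<Rightarrow> 'x mono set" where
  "betti_poset M = {p \<in> lcm_lattice M. \<exists>i.
     (reduced_homology mono_sdvd (lower_complex M p) i :: ('x mono set \<Rightarrow>\<^sub>0 'k) set set)
       \<noteq> {simplicial_boundaries mono_sdvd (lower_complex M p) i}}"

definition poset_iso ::
    "('a \<Rightarrow> 'a \<Rightarrow> bool) \<Rightarrow> 'a set \<Rightarrow> ('b \<Rightarrow> 'b \<Rightarrow> bool) \<Rightarrow> 'b set \<Rightarrow> ('a \<Rightarrow> 'b) \<Rightarrow> bool" where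
  "poset_iso le A le' B g \<longleftrightarrow> bij_betw g A B \<and> (\<forall>p\<in>A. \<forall>q\<in>A. le p q \<longleftrightarrow> le' (g p) (g q))"

section \<open>Multigraded free resolutions with a homogeneous basis\<close>

text \<open>
  \<open>basis F i\<close> is the chosen homogeneous basis of the free module in homological degree \<open>i\<close>,
  \<open>mdeg F i e\<close> is the multidegree of \<open>e \<in> basis F i\<close>, and for \<open>i \<ge> 1\<close>,
  \<open>entry F i e e'\<close> is the coefficient of \<open>e' \<in> basis F (i - 1)\<close> in the image of
  \<open>e \<in> basis F i\<close> under the differential. Values outside these bases are irrelevant.
\<close>

record (overloaded) ('b, 'x, 'k::zero) based_seq =
  basis :: "nat \<Rightarrow> 'b set"
  mdeg :: "nat \<Rightarrow> 'b \<Rightarrow> 'x \<Rightarrow> int"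
  entry :: "nat \<Rightarrow> 'b \<Rightarrow> 'b \<Rightarrow> ('x \<Rightarrow>\<^sub>0 nat) \<Rightarrow>\<^sub>0 'k"

definition homogeneous :: "('x \<Rightarrow> int) \<Rightarrow> ('x, 'k::field) mpoly \<Rightarrow> bool" where
  "homogeneous a p \<longleftrightarrow> (\<forall>m\<in>Poly_Mapping.keys p. \<forall>x. int (Poly_Mapping.lookup m x) = a x)"

definition free_mod ::
    "('b, 'x, 'k::field) based_seq \<Rightarrow> nat \<Rightarrow> ('b \<Rightarrow>\<^sub>0 ('x, 'k) mpoly) set" where
  "free_mod F i = {v. Poly_Mapping.keys v \<subseteq> basis F i}"

text \<open>The differential from homological degree \<open>i\<close> to \<open>i - 1\<close>, for \<open>i \<ge> 1\<close>.\<close>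

definition differential ::
    "('b, 'x, 'k::field) based_seq \<Rightarrow> nat \<Rightarrow> ('b \<Rightarrow>\<^sub>0 ('x, 'k) mpoly) \<Rightarrow> ('b \<Rightarrow>\<^sub>0 ('x, 'k) mpoly)" where
  "differential F i v =
     (\<Sum>e\<in>basis F i. \<Sum>e'\<in>basis F (i - 1).
        Poly_Mapping.single e' (Poly_Mapping.lookup v e * entry F i e e'))"

definition graded_free_seq :: "('b, 'x, 'k::field) based_seq \<Rightarrow> bool" where
  "graded_free_seq F \<longleftrightarrow>
     (\<forall>i. finite (basis F i)) \<and>
     (\<forall>i. \<forall>e\<in>basis F (Suc i). \<forall>e'\<in>basis F i.
        homogeneous (\<lambda>x. mdeg F (Suc i) e x - mdeg F i e' x) (entry F (Suc i) e e'))"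

text \<open>
  A homogeneous augmentation from \<open>free_mod F 0\<close> to the quotient by \<open>M\<close> is given by
  homogeneous representatives \<open>\<epsilon> e\<close> of the images of the basis elements.
\<close>

definition augmentation ::
    "('b, 'x, 'k::field) based_seq \<Rightarrow> ('x, 'k) mpoly set \<Rightarrow> ('b \<Rightarrow> ('x, 'k) mpoly)
      \<Rightarrow> ('b \<Rightarrow>\<^sub>0 ('x, 'k) mpoly) \<Rightarrow> ('x, 'k) mpoly set" where
  "augmentation F M \<epsilon> v = coset M (\<Sum>e\<in>basis F 0. Poly_Mapping.lookup v e * \<epsilon> e)"

definition free_resolution :: "('b, 'x, 'k::field) based_seq \<Rightarrow> ('x, 'k) mpoly set \<Rightarrow> bool" where
  "free_resolution F M \<longleftrightarrow>
     graded_free_seq F \<and>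
     (\<exists>\<epsilon>. (\<forall>e\<in>basis F 0. homogeneous (mdeg F 0 e) (\<epsilon> e)) \<and>
          augmentation F M \<epsilon> ` free_mod F 0 = quot UNIV M \<and>
          {v \<in> free_mod F 0. augmentation F M \<epsilon> v = M} = differential F 1 ` free_mod F 1) \<and>
     (\<forall>i. {v \<in> free_mod F (Suc i). differential F (Suc i) v = 0}
            = differential F (Suc (Suc i)) ` free_mod F (Suc (Suc i)))"

definition minimal_free_resolution ::
    "('b, 'x, 'k::field) based_seq \<Rightarrow> ('x, 'k) mpoly set \<Rightarrow> bool" where
  "minimal_free_resolution F M \<longleftrightarrow>
     free_resolution F M \<and>
     (\<forall>i. \<forall>v\<in>free_mod F (Suc i). \<forall>e\<in>basis F i.
        Poly_Mapping.lookup (differential F (Suc i) v) e \<in> irrelevant_ideal)"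

section \<open>Relabeling\<close>

text \<open>The monomial with exponent vector \<open>a\<close>; only meaningful if \<open>a\<close> is nonnegative.\<close>

definition mono_of :: "('x::finite \<Rightarrow> int) \<Rightarrow> 'x mono" where
  "mono_of a = Poly_Mapping.Abs_poly_mapping (\<lambda>x. nat (a x))"

text \<open>
  The scalar \<open>c\<close> with \<open>entry F i e e' = c * x ^ (a - a')\<close>, where \<open>a\<close>, \<open>a'\<close> are the multidegrees of
  \<open>e\<close>, \<open>e'\<close>. Subtraction of exponents is truncated, but if \<open>a'\<close> does not divide \<open>a\<close>
  then the entry is 0 by homogeneity, and so is \<open>c\<close>.
\<close>

definition struct_coeff :: "('b, 'x::finite, 'k::field) based_seq \<Rightarrow> nat \<Rightarrow> 'b \<Rightarrow> 'b \<Rightarrow> 'k" where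
  "struct_coeff F i e e' =
     Poly_Mapping.lookup (entry F i e e') (mono_of (mdeg F i e) - mono_of (mdeg F (i - 1) e'))"

definition relabel ::
    "('x::finite mono \<Rightarrow> 'y mono) \<Rightarrow> ('b, 'x, 'k::field) based_seq \<Rightarrow> ('b, 'y, 'k) based_seq" where
  "relabel g F =
     \<lparr> basis = basis F,
       mdeg = (\<lambda>i e y. int (Poly_Mapping.lookup (g (mono_of (mdeg F i e))) y)),
       entry = (\<lambda>i e e'. Poly_Mapping.single
          (g (mono_of (mdeg F i e)) - g (mono_of (mdeg F (i - 1) e')))
          (struct_coeff F i e e')) \<rparr>"

end

theory Submission
  imports Defs
begin

text \<open>
  Setting all variables to 1 in a minimal resolution leaves a complex of vector spaces with a
  basis labelled by monomials, its frame, from which the resolution is recovered by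
  homogenization. The strand of the resolution in degree \<open>a\<close> is the subcomplex of the frame on the
  labels dividing \<open>a\<close>, so the resolution property says that this subcomplex is exact for every
  monomial \<open>a\<close> in the ideal. Relabeling changes only the labels, and it suffices to check
  exactness for the new labels at the elements \<open>q \<noteq> 1\<close> of the lcm-lattice of \<open>N\<close>. If \<open>q\<close> is in the
  Betti poset, this is the old exactness at the preimage of \<open>q\<close>. Otherwise no label equals \<open>q\<close>,
  and by induction the subcomplexes below all elements of the open interval \<open>(1, q)\<close> are exact.
  The chains of the order complex of \<open>(1, q)\<close>, each face labelled by its largest vertex, have the
  same property, because an order complex with a largest vertex is a cone. By the method of
  acyclic carriers two such complexes are homotopy equivalent, and the order complex is acyclic
  because \<open>q\<close> is not in the Betti poset. The same comparison shows that the labels of a minimal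
  resolution of \<open>R/M\<close> lie in the Betti poset of \<open>M\<close>.
\<close>

abbreviation "lookup \<equiv> Poly_Mapping.lookup"
abbreviation "keys \<equiv> Poly_Mapping.keys"
abbreviation "single \<equiv> Poly_Mapping.single"

section \<open>Linear maps on finitely supported functions\<close>

definition scalar_mult :: "'k::comm_ring_1 \<Rightarrow> ('a \<Rightarrow>\<^sub>0 'k) \<Rightarrow> ('a \<Rightarrow>\<^sub>0 'k)" where
  "scalar_mult k = Poly_Mapping.map ((*) k)"

abbreviation linear_map :: "(('a \<Rightarrow>\<^sub>0 'k::comm_ring_1) \<Rightarrow> ('b \<Rightarrow>\<^sub>0 'k)) \<Rightarrow> bool" where
  "linear_map \<equiv> module_hom scalar_mult scalar_mult"

definition linear_extension :: "('a \<Rightarrow> 'b \<Rightarrow>\<^sub>0 'k::comm_ring_1) \<Rightarrow> ('a \<Rightarrow>\<^sub>0 'k) \<Rightarrow> ('b \<Rightarrow>\<^sub>0 'k)" where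
  "linear_extension f v = (\<Sum>a\<in>keys v. scalar_mult (lookup v a) (f a))"

lemma lookup_scalar_mult [simp]: "lookup (scalar_mult k v) a = k * lookup v a"
  by (simp add: scalar_mult_def map.rep_eq when_def)

lemma scalar_mult_single [simp]: "scalar_mult k (single a r) = single a (k * r)"
  by (rule poly_mapping_eqI) (simp add: lookup_single when_def)

lemma keys_scalar_mult: "keys (scalar_mult k v) \<subseteq> keys v"
  by (auto simp: in_keys_iff)

interpretation free: module "scalar_mult :: 'k::comm_ring_1 \<Rightarrow> ('a \<Rightarrow>\<^sub>0 'k) \<Rightarrow> ('a \<Rightarrow>\<^sub>0 'k)"
  by unfold_locales (auto intro!: poly_mapping_eqI simp: lookup_add algebra_simps)

interpretation free_pair: module_pair
  "scalar_mult :: 'k::comm_ring_1 \<Rightarrow> ('a \<Rightarrow>\<^sub>0 'k) \<Rightarrow> ('a \<Rightarrow>\<^sub>0 'k)"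
  "scalar_mult :: 'k \<Rightarrow> ('b \<Rightarrow>\<^sub>0 'k) \<Rightarrow> ('b \<Rightarrow>\<^sub>0 'k)" ..

lemma linear_mapI:
  assumes "\<And>v w. f (v + w) = f v + f w" "\<And>k v. f (scalar_mult k v) = scalar_mult k (f v)"
  shows "linear_map f"
  using assms by unfold_locales

lemma linear_map_zero: "linear_map f \<Longrightarrow> f 0 = 0"
  by (rule module_hom.zero)

lemma linear_map_compose: "linear_map f \<Longrightarrow> linear_map g \<Longrightarrow> linear_map (\<lambda>v. g (f v))"
  using module_hom_compose[of scalar_mult scalar_mult f scalar_mult g] by (simp add: o_def)

lemma poly_mapping_sum_single: "(\<Sum>a\<in>keys v. single a (lookup v a)) = v"
  by (rule poly_mapping_eqI) (auto simp: lookup_sum lookup_single when_def sum.delta in_keys_iff)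

lemma keys_sum_subset: "(\<And>i. i \<in> I \<Longrightarrow> keys (f i) \<subseteq> T) \<Longrightarrow> keys (sum f I) \<subseteq> T"
  using keys_sum[of f I] by blast

lemma linear_map_expansion:
  assumes "linear_map f"
  shows "f v = (\<Sum>a\<in>keys v. scalar_mult (lookup v a) (f (single a 1)))"
proof -
  interpret f: module_hom scalar_mult scalar_mult f by fact
  have "f (\<Sum>a\<in>keys v. scalar_mult (lookup v a) (single a 1))
      = (\<Sum>a\<in>keys v. scalar_mult (lookup v a) (f (single a 1)))"
    by (simp add: f.sum f.scale del: scalar_mult_single)
  then show ?thesis by (simp add: poly_mapping_sum_single)
qed

lemma linear_map_eqI:
  assumes "linear_map f" "linear_map g" "\<And>a. a \<in> keys v \<Longrightarrow> f (single a 1) = g (single a 1)"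
  shows "f v = g v"
  unfolding linear_map_expansion[OF assms(1), of v] linear_map_expansion[OF assms(2), of v]
  by (rule sum.cong) (simp_all add: assms(3))

lemma keys_linear_map_subset:
  assumes "linear_map f" "\<And>a. a \<in> keys v \<Longrightarrow> keys (f (single a 1)) \<subseteq> T"
  shows "keys (f v) \<subseteq> T"
  unfolding linear_map_expansion[OF assms(1), of v]
proof (rule keys_sum_subset)
  fix a assume "a \<in> keys v"
  then show "keys (scalar_mult (lookup v a) (f (single a 1))) \<subseteq> T"
    by (rule subset_trans[OF keys_scalar_mult assms(2)])
qed

lemma linear_extension_single [simp]: "linear_extension f (single a k) = scalar_mult k (f a)"
  by (simp add: linear_extension_def)

lemma linear_map_linear_extension: "linear_map (linear_extension f)"
proof (rule linear_mapI)
  have sum_superset: "linear_extension f u = (\<Sum>a\<in>S. scalar_mult (lookup u a) (f a))"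
    if "keys u \<subseteq> S" "finite S" for u S
    unfolding linear_extension_def using that
    by (intro sum.mono_neutral_left) (auto simp: in_keys_iff)
  show "linear_extension f (v + w) = linear_extension f v + linear_extension f w" for v w
    using keys_add[of v w]
    by (simp add: sum_superset[of _ "keys v \<union> keys w"] lookup_add
        free.scale_left_distrib sum.distrib)
  show "linear_extension f (scalar_mult k v) = scalar_mult k (linear_extension f v)" for k v
    by (simp add: sum_superset[of "scalar_mult k v", OF keys_scalar_mult] free.scale_sum_right)
      (simp add: linear_extension_def free.scale_sum_right)
qed

section \<open>Based complexes and exactness\<close>

definition matrix_diff ::
    "(nat \<Rightarrow> 'b set) \<Rightarrow> (nat \<Rightarrow> 'b \<Rightarrow> 'b \<Rightarrow> 'r::comm_ring_1) \<Rightarrow> nat \<Rightarrow> ('b \<Rightarrow>\<^sub>0 'r) \<Rightarrow> ('b \<Rightarrow>\<^sub>0 'r)" where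
  "matrix_diff B c i v = (\<Sum>e\<in>B i. \<Sum>e'\<in>B (i - 1). single e' (lookup v e * c i e e'))"

lemma linear_map_matrix_diff: "linear_map (matrix_diff B c i)"
  by (rule linear_mapI)
    (simp_all add: matrix_diff_def lookup_add distrib_right single_add sum.distrib
      free.scale_sum_right mult.assoc)

lemma lookup_matrix_diff:
  assumes "finite (B i)"
  shows "lookup (matrix_diff B c (Suc i) v) e'
    = (if e' \<in> B i then \<Sum>e\<in>B (Suc i). lookup v e * c (Suc i) e e' else 0)"
  using assms by (simp add: matrix_diff_def lookup_sum lookup_single when_def)

lemma lookup_matrix_diff_single:
  assumes "finite (B i)" "finite (B (Suc i))" "e \<in> B (Suc i)"
  shows "lookup (matrix_diff B c (Suc i) (single e r)) e'
    = (if e' \<in> B i then r * c (Suc i) e e' else 0)"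
proof -
  have "(\<Sum>a\<in>B (Suc i). lookup (single e r) a * c (Suc i) a e') = r * c (Suc i) e e'"
    using assms(2,3)
    by (subst sum.remove[of _ e])
      (auto simp: lookup_single when_def intro!: sum.neutral split: if_splits)
  then show ?thesis by (simp add: lookup_matrix_diff[of B, OF assms(1)])
qed

text \<open>There is no differential out of degree 0, so exactness in degree 0 is surjectivity.\<close>

definition cycles ::
    "(nat \<Rightarrow> ('b \<Rightarrow>\<^sub>0 'r::zero) \<Rightarrow> ('b \<Rightarrow>\<^sub>0 'r)) \<Rightarrow> (nat \<Rightarrow> 'b set) \<Rightarrow> nat \<Rightarrow> ('b \<Rightarrow>\<^sub>0 'r) set" where
  "cycles d S i = {z. keys z \<subseteq> S i \<and> (i = 0 \<or> d i z = 0)}"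

definition exact_at ::
    "(nat \<Rightarrow> ('b \<Rightarrow>\<^sub>0 'r::zero) \<Rightarrow> ('b \<Rightarrow>\<^sub>0 'r)) \<Rightarrow> (nat \<Rightarrow> 'b set) \<Rightarrow> nat \<Rightarrow> bool" where
  "exact_at d S i \<longleftrightarrow> (\<forall>z\<in>cycles d S i. \<exists>w. keys w \<subseteq> S (Suc i) \<and> d (Suc i) w = z)"

definition exact_on :: "(nat \<Rightarrow> ('b \<Rightarrow>\<^sub>0 'r::zero) \<Rightarrow> ('b \<Rightarrow>\<^sub>0 'r)) \<Rightarrow> (nat \<Rightarrow> 'b set) \<Rightarrow> bool" where
  "exact_on d S \<longleftrightarrow> (\<forall>i. exact_at d S i)"

definition below ::
    "('a \<Rightarrow> 'a \<Rightarrow> bool) \<Rightarrow> (nat \<Rightarrow> 'b set) \<Rightarrow> (nat \<Rightarrow> 'b \<Rightarrow> 'a) \<Rightarrow> 'a \<Rightarrow> nat \<Rightarrow> 'b set" where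
  "below le B lab q i = {e \<in> B i. le (lab i e) q}"

lemma exact_onE:
  assumes "exact_on d S" "z \<in> cycles d S i"
  obtains w where "keys w \<subseteq> S (Suc i)" "d (Suc i) w = z"
  using assms unfolding exact_on_def exact_at_def by blast

section \<open>Comparison of labelled resolutions\<close>

definition carried :: "(('b \<Rightarrow>\<^sub>0 'k::comm_ring_1) \<Rightarrow> ('c \<Rightarrow>\<^sub>0 'k)) \<Rightarrow> 'b set \<Rightarrow> ('b \<Rightarrow> 'c set) \<Rightarrow> bool" where
  "carried f A S \<longleftrightarrow> linear_map f \<and> (\<forall>e\<in>A. keys (f (single e 1)) \<subseteq> S e)"

lemma carried_keys:
  assumes "carried f A S" "keys v \<subseteq> A" "\<And>e. e \<in> keys v \<Longrightarrow> S e \<subseteq> T"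
  shows "keys (f v) \<subseteq> T"
proof (rule keys_linear_map_subset[of f])
  show "linear_map f" using assms(1) by (simp add: carried_def)
  show "keys (f (single e 1)) \<subseteq> T" if "e \<in> keys v" for e
    using that assms unfolding carried_def by blast
qed

lemma carried_comp:
  assumes f: "carried f A S" and g: "carried g A' S'"
    and "\<And>e. e \<in> A \<Longrightarrow> S e \<subseteq> A'" "\<And>e e'. e \<in> A \<Longrightarrow> e' \<in> S e \<Longrightarrow> S' e' \<subseteq> T e"
  shows "carried (\<lambda>v. g (f v)) A T"
  unfolding carried_def
proof (intro conjI ballI)
  show "linear_map (\<lambda>v. g (f v))"
    using f g by (simp add: carried_def linear_map_compose)
  show "keys (g (f (single e 1))) \<subseteq> T e" if "e \<in> A" for e
    by (rule carried_keys[OF g]) (use f assms(3,4) that in \<open>force simp: carried_def\<close>)+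
qed

lemma carried_diff: "carried f A S \<Longrightarrow> carried g A S \<Longrightarrow> carried (\<lambda>v. f v - g v) A S"
  unfolding carried_def
  by (auto intro!: free_pair.module_hom_sub dest!: subsetD[OF keys_diff])

lemma ex_carried_lift:
  assumes d: "linear_map d" and r: "linear_map r"
    and hit: "\<And>e. e \<in> A \<Longrightarrow> \<exists>w. keys w \<subseteq> T e \<and> d w = r (single e 1)"
  shows "\<exists>h. carried h A T \<and> (\<forall>v. keys v \<subseteq> A \<longrightarrow> d (h v) = r v)"
proof -
  obtain w where w: "\<And>e. e \<in> A \<Longrightarrow> keys (w e) \<subseteq> T e \<and> d (w e) = r (single e 1)"
    using hit by metis
  define h where "h = linear_extension w"
  have lin_h: "linear_map h" unfolding h_def by (rule linear_map_linear_extension)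
  have "carried h A T" using lin_h w by (simp add: carried_def h_def)
  moreover have "d (h v) = r v" if "keys v \<subseteq> A" for v
  proof (rule linear_map_eqI[where f = "\<lambda>v. d (h v)"])
    show "linear_map (\<lambda>v. d (h v))" by (rule linear_map_compose[OF lin_h d])
    show "d (h (single e 1)) = r (single e 1)" if "e \<in> keys v" for e
      using that \<open>keys v \<subseteq> A\<close> w by (auto simp: h_def)
  qed (fact r)
  ultimately show ?thesis by blast
qed

text \<open>
  The label \<open>base\<close> need not lie in \<open>Q\<close>: over it the complex is the ground ring in degree 0, which is
  not exact.
\<close>

locale labelled_resolution = partial_preordering less_eq
  for less_eq :: "'a \<Rightarrow> 'a \<Rightarrow> bool" (infix "\<^bold>\<le>" 50) +
  fixes base :: 'a and Q :: "'a set"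
    and d :: "nat \<Rightarrow> ('b \<Rightarrow>\<^sub>0 'k::comm_ring_1) \<Rightarrow> ('b \<Rightarrow>\<^sub>0 'k)"
    and B :: "nat \<Rightarrow> 'b set" and lab :: "nat \<Rightarrow> 'b \<Rightarrow> 'a" and e0 :: 'b
  assumes linear_d: "linear_map (d i)"
    and d_d: "keys v \<subseteq> B (Suc (Suc i)) \<Longrightarrow> d (Suc i) (d (Suc (Suc i)) v) = 0"
    and keys_d_single:
      "e \<in> B (Suc i) \<Longrightarrow> keys (d (Suc i) (single e 1)) \<subseteq> below (\<^bold>\<le>) B lab (lab (Suc i) e) i"
    and B_0: "B 0 = {e0}" and lab_0: "lab 0 e0 = base"
    and lab_in_Q: "e \<in> B (Suc i) \<Longrightarrow> lab (Suc i) e \<in> Q"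
    and exact_below: "q \<in> Q \<Longrightarrow> exact_on d (below (\<^bold>\<le>) B lab q)"
begin

abbreviation lower :: "'a \<Rightarrow> nat \<Rightarrow> 'b set" where
  "lower \<equiv> below (\<^bold>\<le>) B lab"

lemma carried_d: "carried (d (Suc i)) (B (Suc i)) (\<lambda>e. lower (lab (Suc i) e) i)"
  using linear_d keys_d_single by (simp add: carried_def)

lemma lower_mono: "q \<^bold>\<le> q' \<Longrightarrow> lower q i \<subseteq> lower q' i"
  by (auto simp: below_def intro: trans)

lemma d_in_cycles:
  assumes v: "keys v \<subseteq> lower q (Suc i)"
  shows "d (Suc i) v \<in> cycles d (lower q) i"
proof -
  have "keys (d (Suc i) v) \<subseteq> lower q i"
  proof (rule carried_keys[OF carried_d])
    show "keys v \<subseteq> B (Suc i)" using v by (auto simp: below_def)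
    show "lower (lab (Suc i) e) i \<subseteq> lower q i" if "e \<in> keys v" for e
      using that v by (intro lower_mono) (auto simp: below_def)
  qed
  moreover have "i = 0 \<or> d i (d (Suc i) v) = 0"
    using d_d v by (cases i) (auto simp: below_def)
  ultimately show ?thesis by (simp add: cycles_def)
qed

end

locale labelled_resolution_pair =
  C: labelled_resolution less_eq base Q d B lab e0 +
  D: labelled_resolution less_eq base Q d' B' lab' e0'
  for less_eq :: "'a \<Rightarrow> 'a \<Rightarrow> bool" (infix "\<^bold>\<le>" 50) and base Q
    and d :: "nat \<Rightarrow> ('b \<Rightarrow>\<^sub>0 'k::comm_ring_1) \<Rightarrow> ('b \<Rightarrow>\<^sub>0 'k)" and B lab e0
    and d' :: "nat \<Rightarrow> ('c \<Rightarrow>\<^sub>0 'k) \<Rightarrow> ('c \<Rightarrow>\<^sub>0 'k)" and B' lab' e0'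
begin

abbreviation carrier :: "nat \<Rightarrow> nat \<Rightarrow> 'b \<Rightarrow> 'c set" where
  "carrier i j e \<equiv> D.lower (lab i e) j"

definition chain_map :: "(nat \<Rightarrow> ('b \<Rightarrow>\<^sub>0 'k) \<Rightarrow> ('c \<Rightarrow>\<^sub>0 'k)) \<Rightarrow> bool" where
  "chain_map f \<longleftrightarrow> (\<forall>i. carried (f i) (B i) (carrier i i)) \<and>
     (\<forall>i v. keys v \<subseteq> B (Suc i) \<longrightarrow> d' (Suc i) (f (Suc i) v) = f i (d (Suc i) v))"

lemma chain_map_carried: "chain_map f \<Longrightarrow> carried (f i) (B i) (carrier i i)"
  by (simp add: chain_map_def)

lemma chain_map_linear: "chain_map f \<Longrightarrow> linear_map (f i)"
  by (simp add: chain_map_def carried_def)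

lemma chain_map_commute:
  "chain_map f \<Longrightarrow> keys v \<subseteq> B (Suc i) \<Longrightarrow> d' (Suc i) (f (Suc i) v) = f i (d (Suc i) v)"
  by (simp add: chain_map_def)

lemma carried_keys_lower:
  assumes "carried f (B i) (carrier i j)" "keys v \<subseteq> C.lower q i"
  shows "keys (f v) \<subseteq> D.lower q j"
proof (rule carried_keys[OF assms(1)])
  show "keys v \<subseteq> B i" using assms(2) by (auto simp: below_def)
  show "carrier i j e \<subseteq> D.lower q j" if "e \<in> keys v" for e
    using that assms(2) by (intro D.lower_mono) (auto simp: below_def)
qed

lemma carried_cycles_lower:
  assumes f: "carried f (B i) (carrier i i)" "\<And>z. z \<in> cycles d B i \<Longrightarrow> i = 0 \<or> d' i (f z) = 0"
    and z: "z \<in> cycles d (C.lower q) i"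
  shows "f z \<in> cycles d' (D.lower q) i"
proof -
  have "z \<in> cycles d B i" using z by (auto simp: cycles_def below_def)
  then show ?thesis using f z carried_keys_lower[OF f(1)] by (simp add: cycles_def)
qed

lemma carried_keys_subset:
  assumes "carried f (B i) (carrier i j)" "keys v \<subseteq> B i"
  shows "keys (f v) \<subseteq> B' j"
  by (rule carried_keys[OF assms]) (auto simp: below_def)

lemma ex_carried_step:
  assumes r: "linear_map r"
    and r_cycle: "\<And>e. e \<in> B (Suc i) \<Longrightarrow>
      r (single e 1) \<in> cycles d' (D.lower (lab (Suc i) e)) j"
  shows "\<exists>h. carried h (B (Suc i)) (carrier (Suc i) (Suc j)) \<and>
    (\<forall>v. keys v \<subseteq> B (Suc i) \<longrightarrow> d' (Suc j) (h v) = r v)"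
proof (rule ex_carried_lift[OF D.linear_d r])
  fix e assume e: "e \<in> B (Suc i)"
  then show "\<exists>w. keys w \<subseteq> carrier (Suc i) (Suc j) e \<and> d' (Suc j) w = r (single e 1)"
    using D.exact_below[OF C.lab_in_Q[OF e]] r_cycle[OF e]
    unfolding exact_on_def exact_at_def by blast
qed

lemma ex_chain_map:
  "\<exists>f. chain_map f \<and> f 0 (single e0 1) = single e0' 1"
proof -
  define admissible where "admissible i f \<longleftrightarrow> carried f (B i) (carrier i i) \<and>
    (\<forall>z\<in>cycles d B i. i = 0 \<or> d' i (f z) = 0) \<and> (i = 0 \<longrightarrow> f (single e0 1) = single e0' 1)" for i f
  define commutes where
    "commutes i f h \<longleftrightarrow> (\<forall>v. keys v \<subseteq> B (Suc i) \<longrightarrow> d' (Suc i) (h v) = f (d (Suc i) v))" for i f h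
  have "\<exists>f. \<forall>i. admissible i (f i) \<and> commutes i (f i) (f (Suc i))"
  proof (rule dependent_nat_choice)
    have "carried (linear_extension (\<lambda>_. single e0' 1)) (B 0) (carrier 0 0)"
      by (simp add: carried_def linear_map_linear_extension below_def
          C.B_0 D.B_0 C.lab_0 D.lab_0 C.refl)
    then show "\<exists>f. admissible 0 f" unfolding admissible_def by (intro exI conjI) (assumption, auto)
  next
    fix f i assume f: "admissible i f"
    have "linear_map (\<lambda>v. f (d (Suc i) v))"
      using f by (intro linear_map_compose[OF C.linear_d]) (simp add: admissible_def carried_def)
    moreover have "f (d (Suc i) (single e 1)) \<in> cycles d' (D.lower (lab (Suc i) e)) i"
      if e: "e \<in> B (Suc i)" for e
    proof (rule carried_cycles_lower)
      show "d (Suc i) (single e 1) \<in> cycles d (C.lower (lab (Suc i) e)) i"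
        using e C.refl by (intro C.d_in_cycles) (simp add: below_def)
    qed (use f in \<open>auto simp: admissible_def\<close>)
    ultimately obtain h where h: "carried h (B (Suc i)) (carrier (Suc i) (Suc i))"
        "\<And>v. keys v \<subseteq> B (Suc i) \<Longrightarrow> d' (Suc i) (h v) = f (d (Suc i) v)"
      using ex_carried_step[of "\<lambda>v. f (d (Suc i) v)" i i] by blast
    have "d' (Suc i) (h z) = 0" if "z \<in> cycles d B (Suc i)" for z
      using that h(2) f by (simp add: cycles_def admissible_def carried_def linear_map_zero)
    then show "\<exists>h. admissible (Suc i) h \<and> commutes i f h"
      using h by (auto simp: admissible_def commutes_def)
  qed
  then obtain f where "\<And>i. admissible i (f i)" "\<And>i. commutes i (f i) (f (Suc i))" by blast
  then show ?thesis
    unfolding chain_map_def admissible_def commutes_def by (intro exI[of _ f]) blast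
qed

lemma chain_map_cycles:
  assumes f: "chain_map f" and z: "z \<in> cycles d B i"
  shows "f i z \<in> cycles d' B' i"
proof -
  have "i = 0 \<or> d' i (f i z) = 0"
  proof (cases i)
    case (Suc j)
    then show ?thesis
      using z chain_map_commute[OF f, of z j] linear_map_zero[OF chain_map_linear[OF f]]
      by (simp add: cycles_def)
  qed simp
  moreover have "keys (f i z) \<subseteq> B' i"
    using carried_keys_subset[OF chain_map_carried[OF f]] z by (simp add: cycles_def)
  ultimately show ?thesis by (simp add: cycles_def)
qed

lemma homotopy_defect_in_cycles:
  assumes \<phi>: "chain_map \<phi>"
    and h: "carried h (B i) (carrier i (Suc i))" "\<And>z. z \<in> cycles d B i \<Longrightarrow> d' (Suc i) (h z) = \<phi> i z"
    and v: "keys v \<subseteq> C.lower q (Suc i)"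
  shows "\<phi> (Suc i) v - h (d (Suc i) v) \<in> cycles d' (D.lower q) (Suc i)"
proof -
  have v_B: "keys v \<subseteq> B (Suc i)" using v by (auto simp: below_def)
  have dv: "d (Suc i) v \<in> cycles d (C.lower q) i" by (rule C.d_in_cycles[OF v])
  have "keys (\<phi> (Suc i) v) \<subseteq> D.lower q (Suc i)"
    by (rule carried_keys_lower[OF chain_map_carried[OF \<phi>] v])
  moreover have "keys (h (d (Suc i) v)) \<subseteq> D.lower q (Suc i)"
    using carried_keys_lower[OF h(1)] dv by (simp add: cycles_def)
  moreover have "d' (Suc i) (h (d (Suc i) v)) = \<phi> i (d (Suc i) v)"
    using dv by (intro h(2)) (auto simp: cycles_def below_def)
  then have "d' (Suc i) (\<phi> (Suc i) v - h (d (Suc i) v)) = 0"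
    by (simp add: module_hom.diff[OF D.linear_d] chain_map_commute[OF \<phi> v_B])
  ultimately show ?thesis
    unfolding cycles_def by (auto dest!: subsetD[OF keys_diff])
qed

lemma chain_map_cycles_are_boundaries:
  assumes \<phi>: "chain_map \<phi>" and \<phi>0: "\<phi> 0 (single e0 1) = 0" and z: "z \<in> cycles d B i"
  shows "\<exists>w. keys w \<subseteq> B' (Suc i) \<and> d' (Suc i) w = \<phi> i z"
proof -
  note lin = chain_map_linear[OF \<phi>]
  define null_homotopy where "null_homotopy i h \<longleftrightarrow> carried h (B i) (carrier i (Suc i)) \<and>
    (\<forall>z\<in>cycles d B i. d' (Suc i) (h z) = \<phi> i z)" for i h
  have "\<exists>h. null_homotopy i h" for i
  proof (induction i)
    case 0
    have "\<phi> 0 z = 0" if "keys z \<subseteq> B 0" for z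
      by (rule linear_map_eqI[OF lin free_pair.module_hom_zero]) (use that \<phi>0 in \<open>auto simp: C.B_0\<close>)
    then have "null_homotopy 0 (\<lambda>_. 0)"
      by (simp add: null_homotopy_def carried_def cycles_def
          free_pair.module_hom_zero linear_map_zero[OF D.linear_d])
    then show ?case by blast
  next
    case (Suc i)
    then obtain h where h: "carried h (B i) (carrier i (Suc i))"
        "\<And>z. z \<in> cycles d B i \<Longrightarrow> d' (Suc i) (h z) = \<phi> i z"
      by (auto simp: null_homotopy_def)
    define r where "r v = \<phi> (Suc i) v - h (d (Suc i) v)" for v
    have "linear_map r"
      unfolding r_def using h(1)
      by (intro free_pair.module_hom_sub lin linear_map_compose[OF C.linear_d])
        (simp add: carried_def)
    moreover have "r (single e 1) \<in> cycles d' (D.lower (lab (Suc i) e)) (Suc i)"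
      if "e \<in> B (Suc i)" for e
      unfolding r_def using that C.refl
      by (intro homotopy_defect_in_cycles[OF \<phi> h]) (simp_all add: below_def)
    ultimately obtain k where k: "carried k (B (Suc i)) (carrier (Suc i) (Suc (Suc i)))"
        "\<And>v. keys v \<subseteq> B (Suc i) \<Longrightarrow> d' (Suc (Suc i)) (k v) = r v"
      using ex_carried_step by blast
    have "r v = \<phi> (Suc i) v" if "v \<in> cycles d B (Suc i)" for v
      using that h(1) by (simp add: r_def cycles_def carried_def linear_map_zero)
    then have "null_homotopy (Suc i) k" using k by (auto simp: null_homotopy_def cycles_def)
    then show ?case by blast
  qed
  then show ?thesis
    using z carried_keys_subset[of _ i "Suc i" z] unfolding null_homotopy_def cycles_def by blast
qed

interpretation flip: labelled_resolution_pair less_eq base Q d' B' lab' e0' d B lab e0 ..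
interpretation self: labelled_resolution_pair less_eq base Q d B lab e0 d B lab e0 ..

lemma chain_map_id_minus_compose:
  assumes f: "chain_map f" and g: "flip.chain_map g"
  shows "self.chain_map (\<lambda>i v. v - g i (f i v))"
  unfolding self.chain_map_def
proof (intro conjI allI impI)
  fix i
  have "carried (\<lambda>v. g i (f i v)) (B i) (self.carrier i i)"
  proof (rule carried_comp[of "f i" _ "carrier i i" "g i" "B' i" "flip.carrier i i"])
    show "carried (f i) (B i) (carrier i i)" "carried (g i) (B' i) (flip.carrier i i)"
      by (rule chain_map_carried[OF f] flip.chain_map_carried[OF g])+
    show "carrier i i e \<subseteq> B' i" for e by (auto simp: below_def)
    show "flip.carrier i i e' \<subseteq> self.carrier i i e" if "e' \<in> carrier i i e" for e e'
      using that by (intro C.lower_mono) (simp add: below_def)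
  qed
  moreover have "carried (\<lambda>v. v) (B i) (self.carrier i i)"
    using free.module_hom_ident C.refl by (auto simp: carried_def below_def)
  ultimately show "carried (\<lambda>v. v - g i (f i v)) (B i) (self.carrier i i)"
    by (intro carried_diff)
next
  fix i and v :: "'b \<Rightarrow>\<^sub>0 'k" assume v: "keys v \<subseteq> B (Suc i)"
  have "keys (f (Suc i) v) \<subseteq> B' (Suc i)"
    by (rule carried_keys_subset[OF chain_map_carried[OF f] v])
  then show "d (Suc i) (v - g (Suc i) (f (Suc i) v)) = d (Suc i) v - g i (f i (d (Suc i) v))"
    by (simp add: module_hom.diff[OF C.linear_d] flip.chain_map_commute[OF g]
        chain_map_commute[OF f v])
qed

lemma exact_on_transfer:
  assumes "exact_on d' B'"
  shows "exact_on d B"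
  unfolding exact_on_def exact_at_def
proof (intro allI ballI)
  fix i z assume z: "z \<in> cycles d B i"
  obtain f where f: "chain_map f" "f 0 (single e0 1) = single e0' 1"
    using ex_chain_map by blast
  obtain g where g: "flip.chain_map g" "g 0 (single e0' 1) = single e0 1"
    using flip.ex_chain_map by blast
  obtain h where h: "keys h \<subseteq> B (Suc i)" "d (Suc i) h = z - g i (f i z)"
    using self.chain_map_cycles_are_boundaries[OF chain_map_id_minus_compose[OF f(1) g(1)] _ z]
    by (auto simp: f(2) g(2))
  obtain u where u: "keys u \<subseteq> B' (Suc i)" "d' (Suc i) u = f i z"
    using assms chain_map_cycles[OF f(1) z] by (rule exact_onE)
  have "keys (g (Suc i) u) \<subseteq> B (Suc i)"
    by (rule flip.carried_keys_subset[OF flip.chain_map_carried[OF g(1)] u(1)])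
  then have "keys (h + g (Suc i) u) \<subseteq> B (Suc i)"
    using h(1) keys_add[of h "g (Suc i) u"] by blast
  moreover have "d (Suc i) (h + g (Suc i) u) = z"
    by (simp add: module_hom.add[OF C.linear_d] h(2) flip.chain_map_commute[OF g(1) u(1)] u(2))
  ultimately show "\<exists>w. keys w \<subseteq> B (Suc i) \<and> d (Suc i) w = z" by blast
qed

end

section \<open>Order complexes\<close>

lemma simplicial_boundary_eq_linear_extension:
  "simplicial_boundary lt
    = linear_extension (\<lambda>\<sigma>. \<Sum>v\<in>\<sigma>. single (\<sigma> - {v}) ((-1) ^ card {u\<in>\<sigma>. lt u v}))"
  by (simp add: fun_eq_iff simplicial_boundary_def linear_extension_def
      free.scale_sum_right mult.commute)

lemma linear_map_simplicial_boundary: "linear_map (simplicial_boundary lt)"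
  unfolding simplicial_boundary_eq_linear_extension by (rule linear_map_linear_extension)

lemma simplicial_boundary_single:
  "simplicial_boundary lt (single \<sigma> 1) = (\<Sum>v\<in>\<sigma>. single (\<sigma> - {v}) ((-1) ^ card {u\<in>\<sigma>. lt u v}))"
  by (simp add: simplicial_boundary_eq_linear_extension)

text \<open>
  The boundary map counts the vertices below the removed one, so joining with an apex above all
  vertices of \<open>\<sigma>\<close> needs the sign \<open>(-1) ^ card \<sigma>\<close>.
\<close>

definition cone :: "'a \<Rightarrow> ('a set \<Rightarrow>\<^sub>0 'k::field) \<Rightarrow> ('a set \<Rightarrow>\<^sub>0 'k)" where
  "cone p = linear_extension (\<lambda>\<sigma>. if p \<in> \<sigma> then 0 else single (insert p \<sigma>) ((-1) ^ card \<sigma>))"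

lemma linear_map_cone: "linear_map (cone p)"
  unfolding cone_def by (rule linear_map_linear_extension)

lemma cone_single:
  "cone p (single \<sigma> k) = (if p \<in> \<sigma> then 0 else single (insert p \<sigma>) (k * (-1) ^ card \<sigma>))"
  by (simp add: cone_def)

context ordering
begin

abbreviation bd :: "('a set \<Rightarrow>\<^sub>0 'k::field) \<Rightarrow> ('a set \<Rightarrow>\<^sub>0 'k)" where
  "bd \<equiv> simplicial_boundary (\<^bold><)"

abbreviation faces :: "'a set \<Rightarrow> nat \<Rightarrow> 'a set set" where
  "faces A i \<equiv> {\<sigma> \<in> order_complex (\<^bold>\<le>) A. card \<sigma> = i}"

lemma boundary_insert_apex:
  assumes fin: "finite \<sigma>" and apex: "p \<notin> \<sigma>" "\<And>u. u \<in> \<sigma> \<Longrightarrow> u \<^bold>\<le> p"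
  shows "bd (single (insert p \<sigma>) (1 :: 'k::field)) = single \<sigma> ((-1) ^ card \<sigma>)
    + (\<Sum>v\<in>\<sigma>. single (insert p (\<sigma> - {v})) ((-1) ^ card {u\<in>\<sigma>. u \<^bold>< v}))"
proof -
  have below_p: "{u \<in> insert p \<sigma>. u \<^bold>< p} = \<sigma>"
    using apex by (auto simp: strict_iff_order)
  have below_v: "{u \<in> insert p \<sigma>. u \<^bold>< v} = {u \<in> \<sigma>. u \<^bold>< v}" if "v \<in> \<sigma>" for v
    using apex(1) apex(2)[OF that] that by (auto simp: strict_iff_order dest: antisym)
  have diff: "insert p \<sigma> - {v} = insert p (\<sigma> - {v})" if "v \<in> \<sigma>" for v
    using that apex(1) by auto
  have "bd (single (insert p \<sigma>) (1 :: 'k)) = single \<sigma> ((-1) ^ card \<sigma>)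
      + (\<Sum>v\<in>\<sigma>. single (insert p \<sigma> - {v}) ((-1) ^ card {u \<in> insert p \<sigma>. u \<^bold>< v}))"
    unfolding simplicial_boundary_single sum.insert[OF fin apex(1)] below_p using apex(1) by simp
  also have "(\<Sum>v\<in>\<sigma>. single (insert p \<sigma> - {v}) ((-1 :: 'k) ^ card {u \<in> insert p \<sigma>. u \<^bold>< v}))
      = (\<Sum>v\<in>\<sigma>. single (insert p (\<sigma> - {v})) ((-1) ^ card {u\<in>\<sigma>. u \<^bold>< v}))"
    by (rule sum.cong[OF HOL.refl]) (simp only: below_v diff)
  finally show ?thesis .
qed

lemma cone_boundary_single:
  assumes fin: "finite \<sigma>" and p: "p \<notin> \<sigma>"
  shows "cone p (bd (single \<sigma> (1 :: 'k::field)))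
    = - (\<Sum>v\<in>\<sigma>. single (insert p (\<sigma> - {v})) ((-1) ^ card \<sigma> * (-1) ^ card {u\<in>\<sigma>. u \<^bold>< v}))"
  unfolding simplicial_boundary_single module_hom.sum[OF linear_map_cone] sum_negf[symmetric]
proof (rule sum.cong[OF HOL.refl])
  fix v assume "v \<in> \<sigma>"
  then have "card \<sigma> = Suc (card (\<sigma> - {v}))" using fin by (metis card_Suc_Diff1)
  then show "cone p (single (\<sigma> - {v}) ((-1 :: 'k) ^ card {u\<in>\<sigma>. u \<^bold>< v}))
      = - single (insert p (\<sigma> - {v})) ((-1) ^ card \<sigma> * (-1) ^ card {u\<in>\<sigma>. u \<^bold>< v})"
    using p by (simp add: cone_single mult.commute flip: single_uminus)
qed

lemma boundary_cone_single:
  assumes fin: "finite \<sigma>" and le: "\<And>u. u \<in> \<sigma> \<Longrightarrow> u \<^bold>\<le> p"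
  shows "bd (cone p (single \<sigma> 1)) + cone p (bd (single \<sigma> 1)) = single \<sigma> (1 :: 'k::field)"
proof (cases "p \<in> \<sigma>")
  case False
  have "bd (cone p (single \<sigma> 1)) = scalar_mult ((-1) ^ card \<sigma>) (bd (single (insert p \<sigma>) (1 :: 'k)))"
    using False by (simp add: cone_single flip: module_hom.scale[OF linear_map_simplicial_boundary])
  then show ?thesis
    by (simp add: boundary_insert_apex[OF fin False le] cone_boundary_single[OF fin False]
        free.scale_right_distrib free.scale_sum_right)
next
  case True
  have below_p: "{u\<in>\<sigma>. u \<^bold>< p} = \<sigma> - {p}"
    using le by (auto simp: strict_iff_order)
  have "cone p (bd (single \<sigma> 1)) = (\<Sum>v\<in>\<sigma>. if v = p then single \<sigma> (1 :: 'k) else 0)"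
    unfolding simplicial_boundary_single module_hom.sum[OF linear_map_cone] using True
    by (intro sum.cong) (auto simp: cone_single below_p insert_absorb)
  also have "\<dots> = single \<sigma> 1" using True fin by simp
  finally show ?thesis
    using True by (simp add: cone_single linear_map_zero[OF linear_map_simplicial_boundary])
qed

lemma boundary_cone:
  assumes "\<And>\<sigma>. \<sigma> \<in> keys c \<Longrightarrow> finite \<sigma> \<and> (\<forall>u\<in>\<sigma>. u \<^bold>\<le> p)"
  shows "bd (cone p c) + cone p (bd c) = (c :: 'a set \<Rightarrow>\<^sub>0 'k::field)"
proof -
  have lin: "linear_map (\<lambda>c :: 'a set \<Rightarrow>\<^sub>0 'k. bd (cone p c) + cone p (bd c))"
    by (intro free_pair.module_hom_add linear_map_compose[OF linear_map_cone]
        linear_map_compose[OF linear_map_simplicial_boundary]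
        linear_map_cone linear_map_simplicial_boundary)
  show ?thesis
    by (rule linear_map_eqI[OF lin free.module_hom_ident]) (use assms boundary_cone_single in blast)
qed

lemma finite_chain_has_greatest:
  assumes "finite \<sigma>" "\<sigma> \<noteq> {}" "\<forall>a\<in>\<sigma>. \<forall>b\<in>\<sigma>. a \<^bold>\<le> b \<or> b \<^bold>\<le> a"
  shows "\<exists>p\<in>\<sigma>. \<forall>u\<in>\<sigma>. u \<^bold>\<le> p"
proof -
  have "transp_on \<sigma> (\<^bold>\<le>)" by (rule transp_onI) (rule trans)
  moreover have "totalp_on \<sigma> (\<^bold>\<le>)" using assms(3) by (auto intro: totalp_onI)
  ultimately obtain p where p: "p \<in> \<sigma>" "\<forall>u\<in>\<sigma>. u \<noteq> p \<longrightarrow> u \<^bold>\<le> p"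
    using Finite_Set.bex_greatest_element[OF assms(1,2)] by blast
  then have "u \<^bold>\<le> p" if "u \<in> \<sigma>" for u
    using that refl[of p] by (cases "u = p") auto
  then show ?thesis using p(1) by blast
qed

lemma boundary_boundary_single:
  assumes "finite \<sigma>" "\<forall>a\<in>\<sigma>. \<forall>b\<in>\<sigma>. a \<^bold>\<le> b \<or> b \<^bold>\<le> a"
  shows "bd (bd (single \<sigma> (1 :: 'k::field))) = 0"
  using assms
proof (induction "card \<sigma>" arbitrary: \<sigma>)
  case 0
  then show ?case
    by (simp add: simplicial_boundary_single linear_map_zero[OF linear_map_simplicial_boundary])
next
  case (Suc n)
  obtain p where p: "p \<in> \<sigma>" "\<forall>u\<in>\<sigma>. u \<^bold>\<le> p"
    using finite_chain_has_greatest[of \<sigma>] Suc by (metis card.empty nat.distinct(1))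
  define t :: "'a set \<Rightarrow>\<^sub>0 'k" where "t = single (\<sigma> - {p}) 1"
  have below_p: "finite \<rho> \<and> (\<forall>u\<in>\<rho>. u \<^bold>\<le> p)" if "\<rho> \<subseteq> \<sigma>" for \<rho>
    using that p(2) Suc.prems(1) finite_subset by blast
  have "keys (bd t) \<subseteq> Pow \<sigma>"
    unfolding t_def simplicial_boundary_single by (rule keys_sum_subset) auto
  then have cone_bd: "bd (cone p (bd t)) + cone p (bd (bd t)) = bd t"
    using below_p by (intro boundary_cone) blast
  have "bd (bd t) = 0"
    unfolding t_def using Suc.hyps Suc.prems p(1) by (intro Suc.hyps(1)) auto
  then have "bd (cone p (bd t)) = bd t"
    using cone_bd by (simp add: linear_map_zero[OF linear_map_cone])
  moreover have "bd (cone p t) = t - cone p (bd t)"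
    using boundary_cone[of t p] below_p[of "\<sigma> - {p}"] by (simp add: t_def eq_diff_eq)
  ultimately have "bd (bd (cone p t)) = 0"
    by (simp add: module_hom.diff[OF linear_map_simplicial_boundary])
  moreover have "single \<sigma> 1 = scalar_mult ((-1) ^ card (\<sigma> - {p})) (cone p t)"
    using p(1) by (simp add: t_def cone_single insert_absorb)
  ultimately show ?case
    by (simp add: module_hom.scale[OF linear_map_simplicial_boundary])
qed

lemma boundary_boundary:
  assumes "keys c \<subseteq> order_complex (\<^bold>\<le>) A"
  shows "bd (bd c) = (0 :: 'a set \<Rightarrow>\<^sub>0 'k::field)"
proof (rule linear_map_eqI[where f = "\<lambda>c. bd (bd c)", OF _ free_pair.module_hom_zero])
  show "linear_map (\<lambda>c :: 'a set \<Rightarrow>\<^sub>0 'k. bd (bd c))"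
    by (rule linear_map_compose[OF linear_map_simplicial_boundary linear_map_simplicial_boundary])
  show "bd (bd (single \<sigma> (1 :: 'k))) = 0" if "\<sigma> \<in> keys c" for \<sigma>
    using that assms by (intro boundary_boundary_single) (auto simp: order_complex_def)
qed

lemma cycles_faces_iff:
  "z \<in> cycles (\<lambda>_. bd) (faces A) i \<longleftrightarrow> keys z \<subseteq> faces A i \<and> bd z = (0 :: 'a set \<Rightarrow>\<^sub>0 'k::field)"
proof (cases "i = 0")
  case True
  have "bd z = 0" if "keys z \<subseteq> faces A 0"
  proof -
    have "keys z \<subseteq> {{}}" using that by (auto simp: order_complex_def)
    then show ?thesis unfolding simplicial_boundary_def by (intro sum.neutral ballI) auto
  qed
  then show ?thesis using True by (auto simp: cycles_def)
qed (simp add: cycles_def)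

lemma exact_on_faces_if_greatest:
  assumes p: "p \<in> A" "\<And>a. a \<in> A \<Longrightarrow> a \<^bold>\<le> p"
  shows "exact_on (\<lambda>_. bd :: ('a set \<Rightarrow>\<^sub>0 'k::field) \<Rightarrow> _) (faces A)"
  unfolding exact_on_def exact_at_def
proof (intro allI ballI)
  fix i and z :: "'a set \<Rightarrow>\<^sub>0 'k" assume "z \<in> cycles (\<lambda>_. bd) (faces A) i"
  then have bd_z: "bd z = 0" and keys_z: "keys z \<subseteq> faces A i" by (simp_all add: cycles_faces_iff)
  then have faces: "finite \<sigma>" "\<sigma> \<subseteq> A" "\<sigma> \<in> faces A i" if "\<sigma> \<in> keys z" for \<sigma>
    using that by (auto simp: order_complex_def)
  have "bd (cone p z) + cone p (bd z) = z"
    by (rule boundary_cone) (use faces p(2) in blast)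
  then have "bd (cone p z) = z" by (simp add: bd_z linear_map_zero[OF linear_map_cone])
  moreover have "keys (cone p z) \<subseteq> faces A (Suc i)"
  proof (rule keys_linear_map_subset[OF linear_map_cone])
    show "keys (cone p (single \<sigma> 1)) \<subseteq> faces A (Suc i)" if "\<sigma> \<in> keys z" for \<sigma>
      using faces[OF that] p by (auto simp: cone_single order_complex_def refl)
  qed
  ultimately show "\<exists>w. keys w \<subseteq> faces A (Suc i) \<and> bd w = z" by blast
qed

definition top_vertex :: "'a \<Rightarrow> 'a set \<Rightarrow> 'a" where
  "top_vertex base \<sigma> = (THE p. p \<in> insert base \<sigma> \<and> (\<forall>u\<in>insert base \<sigma>. u \<^bold>\<le> p))"

context
  fixes base :: 'a and Q :: "'a set"
  assumes base: "\<And>q. q \<in> Q \<Longrightarrow> base \<^bold>\<le> q"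
begin

lemma top_vertex_greatest:
  assumes "\<sigma> \<in> order_complex (\<^bold>\<le>) Q"
  shows "top_vertex base \<sigma> \<in> insert base \<sigma> \<and> (\<forall>u\<in>insert base \<sigma>. u \<^bold>\<le> top_vertex base \<sigma>)"
proof -
  have "\<exists>p\<in>insert base \<sigma>. \<forall>u\<in>insert base \<sigma>. u \<^bold>\<le> p"
  proof (rule finite_chain_has_greatest)
    have \<sigma>: "\<sigma> \<subseteq> Q" "\<forall>a\<in>\<sigma>. \<forall>b\<in>\<sigma>. a \<^bold>\<le> b \<or> b \<^bold>\<le> a"
      using assms by (auto simp: order_complex_def)
    then show "\<forall>a\<in>insert base \<sigma>. \<forall>b\<in>insert base \<sigma>. a \<^bold>\<le> b \<or> b \<^bold>\<le> a"
      using base refl by blast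
    show "finite (insert base \<sigma>)" using assms by (simp add: order_complex_def)
  qed simp
  then obtain p where p: "p \<in> insert base \<sigma> \<and> (\<forall>u\<in>insert base \<sigma>. u \<^bold>\<le> p)" by blast
  have "q = p" if "q \<in> insert base \<sigma> \<and> (\<forall>u\<in>insert base \<sigma>. u \<^bold>\<le> q)" for q
    by (rule antisym) (use p that in blast)+
  with p have "top_vertex base \<sigma> = p" unfolding top_vertex_def by (rule the_equality)
  with p show ?thesis by simp
qed

lemma top_vertex_le_iff:
  assumes "\<sigma> \<in> order_complex (\<^bold>\<le>) Q"
  shows "top_vertex base \<sigma> \<^bold>\<le> q \<longleftrightarrow> base \<^bold>\<le> q \<and> (\<forall>u\<in>\<sigma>. u \<^bold>\<le> q)"
proof
  assume "top_vertex base \<sigma> \<^bold>\<le> q"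
  then have "u \<^bold>\<le> q" if "u \<in> insert base \<sigma>" for u
    using that top_vertex_greatest[OF assms] trans[of u "top_vertex base \<sigma>" q] by blast
  then show "base \<^bold>\<le> q \<and> (\<forall>u\<in>\<sigma>. u \<^bold>\<le> q)" by blast
next
  assume "base \<^bold>\<le> q \<and> (\<forall>u\<in>\<sigma>. u \<^bold>\<le> q)"
  then show "top_vertex base \<sigma> \<^bold>\<le> q" using top_vertex_greatest[OF assms] by auto
qed

lemma top_vertex_in:
  assumes "\<sigma> \<in> order_complex (\<^bold>\<le>) Q" "\<sigma> \<noteq> {}"
  shows "top_vertex base \<sigma> \<in> Q"
proof -
  obtain u where u: "u \<in> \<sigma>" using assms(2) by blast
  have \<sigma>: "\<sigma> \<subseteq> Q" using assms(1) by (simp add: order_complex_def)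
  note top = top_vertex_greatest[OF assms(1)]
  show ?thesis
  proof (cases "top_vertex base \<sigma> = base")
    case True
    then have "u = base" using antisym[of u base] top base u \<sigma> by auto
    then show ?thesis using True u \<sigma> by auto
  next
    case False
    then show ?thesis using top \<sigma> by blast
  qed
qed

lemma keys_boundary_below_top_vertex:
  assumes \<sigma>: "\<sigma> \<in> faces Q (Suc i)"
  shows "keys (bd (single \<sigma> (1 :: 'k::field)))
    \<subseteq> below (\<^bold>\<le>) (faces Q) (\<lambda>_. top_vertex base) (top_vertex base \<sigma>) i"
  unfolding simplicial_boundary_single
proof (rule keys_sum_subset)
  fix v assume v: "v \<in> \<sigma>"
  then have face: "\<sigma> - {v} \<in> faces Q i" using \<sigma> by (auto simp: order_complex_def)
  then have "top_vertex base (\<sigma> - {v}) \<^bold>\<le> top_vertex base \<sigma>"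
    using top_vertex_le_iff[of "\<sigma> - {v}"] top_vertex_greatest[of \<sigma>] \<sigma> by blast
  with face show "keys (single (\<sigma> - {v}) ((-1 :: 'k) ^ card {u\<in>\<sigma>. u \<^bold>< v}))
      \<subseteq> below (\<^bold>\<le>) (faces Q) (\<lambda>_. top_vertex base) (top_vertex base \<sigma>) i"
    by (simp add: below_def)
qed

lemma below_faces:
  assumes "q \<in> Q"
  shows "below (\<^bold>\<le>) (faces Q) (\<lambda>_. top_vertex base) q = faces {r \<in> Q. r \<^bold>\<le> q}"
  using top_vertex_le_iff base[OF assms] by (auto simp: below_def fun_eq_iff order_complex_def)

lemma labelled_resolution_faces:
  "labelled_resolution (\<^bold>\<le>) base Q (\<lambda>_. bd :: ('a set \<Rightarrow>\<^sub>0 'k::field) \<Rightarrow> _)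
    (faces Q) (\<lambda>_. top_vertex base) {}"
proof (intro labelled_resolution.intro labelled_resolution_axioms.intro)
  show "partial_preordering (\<^bold>\<le>)" by (rule partial_preordering_axioms)
  show "linear_map (bd :: ('a set \<Rightarrow>\<^sub>0 'k) \<Rightarrow> _)" by (rule linear_map_simplicial_boundary)
  show "bd (bd v) = 0" if "keys v \<subseteq> faces Q (Suc (Suc i))" for v :: "'a set \<Rightarrow>\<^sub>0 'k" and i
    by (rule boundary_boundary[of v Q]) (use that in blast)
  show "faces Q 0 = {{}}" by (auto simp: order_complex_def)
  show "top_vertex base {} = base"
    using top_vertex_greatest[of "{}"] by (simp add: order_complex_def)
  show "top_vertex base \<sigma> \<in> Q" if "\<sigma> \<in> faces Q (Suc i)" for \<sigma> i
    by (rule top_vertex_in) (use that in auto)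
  show "keys (bd (single \<sigma> (1 :: 'k)))
      \<subseteq> below (\<^bold>\<le>) (faces Q) (\<lambda>_. top_vertex base) (top_vertex base \<sigma>) i"
    if "\<sigma> \<in> faces Q (Suc i)" for \<sigma> i
    using that by (rule keys_boundary_below_top_vertex)
  show "exact_on (\<lambda>_. bd :: ('a set \<Rightarrow>\<^sub>0 'k) \<Rightarrow> _) (below (\<^bold>\<le>) (faces Q) (\<lambda>_. top_vertex base) q)"
    if q: "q \<in> Q" for q
    unfolding below_faces[OF q] by (rule exact_on_faces_if_greatest[of q]) (use q refl in auto)
qed

end

end

section \<open>Monomials\<close>

interpretation mono_ord: ordering mono_dvd mono_sdvd
proof
  show "mono_dvd a c" if "mono_dvd a b" "mono_dvd b c" for a b c :: "'a mono"
    using that le_trans unfolding mono_dvd_def by blast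
  show "a = b" if "mono_dvd a b" "mono_dvd b a" for a b :: "'a mono"
    using that by (auto simp: mono_dvd_def intro!: poly_mapping_eqI antisym)
qed (auto simp: mono_dvd_def mono_sdvd_def)

lemma mono_dvd_zero [simp]: "mono_dvd 0 m"
  by (simp add: mono_dvd_def)

lemma mono_dvd_zero_iff [simp]: "mono_dvd m 0 \<longleftrightarrow> m = 0"
  by (auto simp: mono_dvd_def intro!: poly_mapping_eqI)

lemma mono_dvd_add: "mono_dvd m (n + m)"
  by (simp add: mono_dvd_def lookup_add)

lemma mono_dvd_diff_add: "mono_dvd m n \<Longrightarrow> n - m + m = n"
  by (rule poly_mapping_eqI) (simp add: mono_dvd_def lookup_add lookup_minus)

lemma mono_dvd_diff_zero_iff: "mono_dvd m n \<Longrightarrow> n - m = 0 \<longleftrightarrow> n = m"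
  using mono_dvd_diff_add[of m n] by auto

lemma mono_diff_diff: "mono_dvd l m \<Longrightarrow> n - l - (m - l) = n - m"
  by (rule poly_mapping_eqI) (simp add: mono_dvd_def lookup_minus)

lemma mono_dvd_diff_iff:
  assumes "mono_dvd l m" "mono_dvd l n"
  shows "mono_dvd (m - l) (n - l) \<longleftrightarrow> mono_dvd m n"
  using assms by (simp add: mono_dvd_def lookup_minus le_diff_iff)

lemma wfp_mono_sdvd: "wfp (mono_sdvd :: 'x::finite mono \<Rightarrow> 'x mono \<Rightarrow> bool)"
proof (rule wfp_if_convertible_to_nat)
  fix m n :: "'x mono"
  assume mn: "mono_sdvd m n"
  have "(\<forall>x. lookup m x \<le> lookup n x) \<and> (\<exists>x. lookup m x \<noteq> lookup n x)"
    using mn by (auto simp: mono_sdvd_def mono_dvd_def poly_mapping_eq_iff fun_eq_iff)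
  then show "(\<Sum>x\<in>UNIV. lookup m x) < (\<Sum>x\<in>UNIV. lookup n x)"
    by (intro sum_strict_mono_ex1) (auto intro: le_neq_implies_less)
qed

lemma ex_incseq_subseq_nat:
  fixes u :: "nat \<Rightarrow> nat"
  shows "\<exists>r :: nat \<Rightarrow> nat. strict_mono r \<and> incseq (u \<circ> r)"
proof -
  obtain f where f: "strict_mono (f :: nat \<Rightarrow> nat)" "monoseq (\<lambda>n. u (f n))"
    using seq_monosub by blast
  show ?thesis
  proof (cases "incseq (\<lambda>n. u (f n))")
    case True
    then show ?thesis using f by (auto simp: o_def)
  next
    case False
    then have dec: "decseq (\<lambda>n. u (f n))" using f monoseq_iff by blast
    define v where "v = (LEAST k. k \<in> range (\<lambda>n. u (f n)))"
    have "v \<in> range (\<lambda>n. u (f n))"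
      unfolding v_def by (rule LeastI) auto
    then obtain m where m: "v = u (f m)" by auto
    have "u (f (n + m)) = v" for n
    proof (rule antisym)
      show "u (f (n + m)) \<le> v" using dec m by (simp add: decseq_def)
      show "v \<le> u (f (n + m))" unfolding v_def by (rule Least_le) auto
    qed
    then have "incseq (u \<circ> (\<lambda>n. f (n + m)))" by (simp add: incseq_def)
    moreover have "strict_mono (\<lambda>n. f (n + m))" using f(1) by (simp add: strict_mono_def)
    ultimately show ?thesis by blast
  qed
qed

lemma ex_coordinatewise_incseq_subseq:
  fixes s :: "nat \<Rightarrow> 'x \<Rightarrow> nat"
  assumes "finite X"
  shows "\<exists>r :: nat \<Rightarrow> nat. strict_mono r \<and> (\<forall>x\<in>X. incseq (\<lambda>n. s (r n) x))"
  using assms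
proof (induction X)
  case empty
  then show ?case using strict_mono_id by blast
next
  case (insert x X)
  then obtain r where r: "strict_mono (r :: nat \<Rightarrow> nat)" "\<forall>x\<in>X. incseq (\<lambda>n. s (r n) x)" by blast
  obtain r' where r': "strict_mono (r' :: nat \<Rightarrow> nat)" "incseq ((\<lambda>n. s (r n) x) \<circ> r')"
    using ex_incseq_subseq_nat by blast
  have "strict_mono (r \<circ> r')" using r(1) r'(1) by (rule strict_mono_o)
  moreover have "incseq (\<lambda>n. s ((r \<circ> r') n) y)" if "y \<in> insert x X" for y
    using that r(2) r' by (auto simp: incseq_def o_def strict_mono_less_eq)
  ultimately show ?case by blast
qed

lemma finite_mono_antichain:
  fixes A :: "'x::finite mono set"
  assumes "\<And>m n. m \<in> A \<Longrightarrow> n \<in> A \<Longrightarrow> mono_dvd m n \<Longrightarrow> m = n"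
  shows "finite A"
proof (rule ccontr)
  assume "infinite A"
  then obtain s :: "nat \<Rightarrow> 'x mono" where s: "inj s" "range s \<subseteq> A"
    using infinite_countable_subset by blast
  obtain r :: "nat \<Rightarrow> nat" where r: "strict_mono r" "\<forall>x\<in>UNIV. incseq (\<lambda>n. lookup (s (r n)) x)"
    using ex_coordinatewise_incseq_subseq[of UNIV "\<lambda>n. lookup (s n)"] by auto
  have "mono_dvd (s (r 0)) (s (r 1))"
    using r(2) by (simp add: mono_dvd_def incseq_def)
  then have "s (r 0) = s (r 1)" using assms s(2) by blast
  then show False using s(1) r(1) by (metis injD strict_mono_less less_irrefl zero_less_one)
qed

lemma lookup_mono_lcm:
  "lookup (mono_lcm A) x = Max (insert 0 ((\<lambda>m. lookup m x) ` A))"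
  unfolding mono_lcm_def by (subst lookup_Abs_poly_mapping) auto

lemma dvd_mono_lcm: "finite A \<Longrightarrow> m \<in> A \<Longrightarrow> mono_dvd m (mono_lcm A)"
  by (auto simp: mono_dvd_def lookup_mono_lcm intro!: Max_ge)

lemma mono_lcm_dvd: "finite A \<Longrightarrow> (\<And>m. m \<in> A \<Longrightarrow> mono_dvd m n) \<Longrightarrow> mono_dvd (mono_lcm A) n"
  by (auto simp: mono_dvd_def lookup_mono_lcm)

lemma mono_lcm_empty [simp]: "mono_lcm {} = 0"
  by (rule poly_mapping_eqI) (simp add: lookup_mono_lcm)

section \<open>Monomial ideals\<close>

lemma lookup_times_single:
  fixes p :: "'x mono \<Rightarrow>\<^sub>0 'r::semiring_0"
  shows "lookup (p * single m c) n = (if mono_dvd m n then lookup p (n - m) * c else 0)"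
proof -
  have "(\<Sum>k\<in>keys p. single k (lookup p k)) * single m c
      = (\<Sum>k\<in>keys p. single (k + m) (lookup p k * c))"
    by (simp add: sum_distrib_right mult_single)
  then have expansion:
      "lookup (p * single m c) n = (\<Sum>k\<in>keys p. if k + m = n then lookup p k * c else 0)"
    by (simp add: poly_mapping_sum_single lookup_sum lookup_single when_def)
  show ?thesis
  proof (cases "mono_dvd m n")
    case True
    have "k + m = n \<longleftrightarrow> k = n - m" for k
      using mono_dvd_diff_add[OF True] by auto
    then show ?thesis using True unfolding expansion by (auto simp: sum.delta in_keys_iff)
  next
    case False
    then have "k + m \<noteq> n" for k using mono_dvd_add by blast
    then show ?thesis using False unfolding expansion by simp
  qed
qed

interpretation mpoly_module: module "(*) :: ('x, 'k::field) mpoly \<Rightarrow> _"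
  by unfold_locales (auto simp: algebra_simps)

lemma subspace_divisible_monomials:
  "mpoly_module.subspace {p :: ('x, 'k::field) mpoly. \<forall>m\<in>keys p. \<exists>a\<in>A. mono_dvd a m}"
  (is "module.subspace _ ?I")
proof (rule mpoly_module.subspaceI)
  show "p + q \<in> ?I" if "p \<in> ?I" "q \<in> ?I" for p q
    using that keys_add[of p q] by auto
  show "c * p \<in> ?I" if p: "p \<in> ?I" for c p
  proof safe
    fix m assume "m \<in> keys (c * p)"
    then obtain k n where m: "m = k + n" "n \<in> keys p"
      using keys_mult[of c p] by auto
    then obtain a where "a \<in> A" "mono_dvd a n" using p by auto
    then show "\<exists>a\<in>A. mono_dvd a m"
      using mono_ord.trans[of a n m] mono_dvd_add[of n k] m(1) by auto
  qed
qed simp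

lemma ideal_gen_monom_poly:
  "ideal_gen (monom_poly ` A :: ('x, 'k::field) mpoly set) = {p. \<forall>m\<in>keys p. \<exists>a\<in>A. mono_dvd a m}"
  (is "_ = ?I")
proof
  have "monom_poly ` A \<subseteq> ?I"
    by (auto simp: monom_poly_def intro: mono_ord.refl)
  then show "ideal_gen (monom_poly ` A) \<subseteq> ?I"
    using mpoly_module.span_minimal[OF _ subspace_divisible_monomials] by (simp only: ideal_gen_def)
next
  show "?I \<subseteq> ideal_gen (monom_poly ` A)"
  proof
    fix p :: "('x, 'k) mpoly" assume p: "p \<in> ?I"
    have "single m (lookup p m) \<in> ideal_gen (monom_poly ` A)" if m: "m \<in> keys p" for m
    proof -
      obtain a where a: "a \<in> A" "mono_dvd a m" using p m by blast
      have "single m (lookup p m) = single (m - a) (lookup p m) * monom_poly a"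
        using mono_dvd_diff_add[OF a(2)] by (simp add: monom_poly_def mult_single)
      then show ?thesis
        using a(1) unfolding ideal_gen_def
        by (simp add: mpoly_module.span_scale mpoly_module.span_base)
    qed
    then have "(\<Sum>m\<in>keys p. single m (lookup p m)) \<in> ideal_gen (monom_poly ` A)"
      unfolding ideal_gen_def by (intro mpoly_module.span_sum)
    then show "p \<in> ideal_gen (monom_poly ` A)" by (simp add: poly_mapping_sum_single)
  qed
qed

lemma irrelevant_ideal_iff:
  fixes p :: "('x, 'k::field) mpoly"
  shows "p \<in> irrelevant_ideal \<longleftrightarrow> lookup p 0 = 0"
proof -
  have "(\<exists>x. mono_dvd (single x 1) m) \<longleftrightarrow> m \<noteq> 0" for m :: "'x mono"
  proof
    assume "m \<noteq> 0"
    then obtain x where "lookup m x \<noteq> 0" by (metis poly_mapping_eqI lookup_zero)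
    then show "\<exists>x. mono_dvd (single x 1) m"
      by (auto simp: mono_dvd_def lookup_single when_def intro!: exI[of _ x])
  next
    assume "\<exists>x. mono_dvd (single x 1) m"
    then obtain x where "lookup (single x (1 :: nat)) x \<le> lookup m x"
      unfolding mono_dvd_def by blast
    then show "m \<noteq> 0" by auto
  qed
  moreover have "irrelevant_ideal
      = ideal_gen (monom_poly ` range (\<lambda>x. single x 1) :: ('x, 'k) mpoly set)"
    by (simp add: irrelevant_ideal_def image_image)
  ultimately have "irrelevant_ideal = {p :: ('x, 'k) mpoly. 0 \<notin> keys p}"
    by (auto simp: ideal_gen_monom_poly)
  then have "p \<in> irrelevant_ideal \<longleftrightarrow> p \<in> {p :: ('x, 'k) mpoly. 0 \<notin> keys p}" by (rule arg_cong)
  then show ?thesis by (simp add: in_keys_iff)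
qed

lemma lookup_0_mult:
  fixes p q :: "('x, 'k::field) mpoly"
  shows "lookup q 0 = 0 \<Longrightarrow> lookup (p * q) 0 = 0"
  using mpoly_module.span_scale[of q _ p]
  by (simp add: irrelevant_ideal_iff[symmetric] irrelevant_ideal_def ideal_gen_def)

lemma finite_min_gens: "finite (min_gens (M :: ('x::finite, 'k::field) mpoly set))"
  by (rule finite_mono_antichain) (auto simp: min_gens_def)

lemma ex_min_gens_dvd:
  fixes M :: "('x::finite, 'k::field) mpoly set"
  assumes "monom_poly m \<in> M"
  shows "\<exists>n\<in>min_gens M. mono_dvd n m"
  using assms
proof (induction m rule: wfp_induct_rule[OF wfp_mono_sdvd])
  case (1 m)
  show ?case
  proof (cases "m \<in> min_gens M")
    case True
    then show ?thesis using mono_ord.refl by blast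
  next
    case False
    then obtain n where "monom_poly n \<in> M" "mono_dvd n m" "n \<noteq> m"
      using 1(2) by (auto simp: min_gens_def)
    then obtain l where "l \<in> min_gens M" "mono_dvd l n"
      using 1(1)[of n] by (auto simp: mono_sdvd_def)
    then show ?thesis using \<open>mono_dvd n m\<close> mono_ord.trans by blast
  qed
qed

definition lcm_below :: "('x::finite, 'k::field) mpoly set \<Rightarrow> 'x mono \<Rightarrow> 'x mono" where
  "lcm_below M a = mono_lcm {m \<in> min_gens M. mono_dvd m a}"

lemma zero_in_lcm_lattice: "0 \<in> lcm_lattice M"
  unfolding lcm_lattice_def by (auto intro!: exI[of _ "{}"])

lemma lcm_below_in_lcm_lattice: "lcm_below M a \<in> lcm_lattice M"
  by (auto simp: lcm_below_def lcm_lattice_def)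

lemma lcm_below_dvd: "mono_dvd (lcm_below M a) a"
  unfolding lcm_below_def by (intro mono_lcm_dvd) (auto simp: finite_min_gens)

lemma min_gens_dvd_lcm_below: "m \<in> min_gens M \<Longrightarrow> mono_dvd m a \<Longrightarrow> mono_dvd m (lcm_below M a)"
  unfolding lcm_below_def by (intro dvd_mono_lcm) (auto simp: finite_min_gens)

lemma dvd_lcm_below_iff:
  assumes "p \<in> lcm_lattice M"
  shows "mono_dvd p (lcm_below M a) \<longleftrightarrow> mono_dvd p a"
proof
  assume "mono_dvd p (lcm_below M a)"
  then show "mono_dvd p a" using lcm_below_dvd by (rule mono_ord.trans)
next
  assume p: "mono_dvd p a"
  obtain A where A: "A \<subseteq> min_gens M" "p = mono_lcm A"
    using assms by (auto simp: lcm_lattice_def)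
  have fin: "finite A" by (rule finite_subset[OF A(1) finite_min_gens])
  show "mono_dvd p (lcm_below M a)" unfolding A(2)
  proof (rule mono_lcm_dvd[OF fin])
    fix m assume m: "m \<in> A"
    then have "mono_dvd m a" using mono_ord.trans[OF dvd_mono_lcm[OF fin m]] p A(2) by simp
    then show "mono_dvd m (lcm_below M a)" using m A(1) by (intro min_gens_dvd_lcm_below) auto
  qed
qed

lemma monomial_idealE:
  assumes "monomial_ideal (M :: ('x, 'k::field) mpoly set)"
  obtains A where "M = {p. \<forall>m\<in>keys p. \<exists>a\<in>A. mono_dvd a m}"
  using assms unfolding monomial_ideal_def ideal_gen_monom_poly by blast

context
  fixes M :: "('x, 'k::field) mpoly set"
  assumes M: "monomial_ideal M"
begin

lemma monomial_ideal_iff: "p \<in> M \<longleftrightarrow> (\<forall>m\<in>keys p. monom_poly m \<in> M)"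
  by (rule monomial_idealE[OF M]) (simp add: monom_poly_def)

lemma monomial_ideal_dvd:
  assumes "monom_poly m \<in> M" "mono_dvd m n"
  shows "monom_poly n \<in> M"
proof -
  obtain A where A: "M = {p. \<forall>m\<in>keys p. \<exists>a\<in>A. mono_dvd a m}" by (rule monomial_idealE[OF M])
  then obtain a where "a \<in> A" "mono_dvd a m" using assms(1) by (auto simp: monom_poly_def)
  then show ?thesis using mono_ord.trans[OF _ assms(2)] by (auto simp: A monom_poly_def)
qed

lemma monomial_ideal_single: "c \<noteq> 0 \<Longrightarrow> single m c \<in> M \<longleftrightarrow> monom_poly m \<in> M"
  by (subst monomial_ideal_iff) simp

lemma subspace_monomial_ideal: "mpoly_module.subspace M"
  by (rule monomial_idealE[OF M]) (simp add: subspace_divisible_monomials)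

lemma monomial_ideal_one_iff: "monom_poly 0 \<in> M \<longleftrightarrow> M = UNIV"
proof
  assume "monom_poly 0 \<in> M"
  then have "p \<in> M" for p
    by (subst monomial_ideal_iff) (auto intro: monomial_ideal_dvd)
  then show "M = UNIV" by blast
qed simp

end

lemma lcm_lattice_in_ideal:
  fixes M :: "('x::finite, 'k::field) mpoly set"
  assumes M: "monomial_ideal M" and p: "p \<in> lcm_lattice M" "p \<noteq> 0"
  shows "monom_poly p \<in> M"
proof -
  obtain A where A: "A \<subseteq> min_gens M" "p = mono_lcm A"
    using p by (auto simp: lcm_lattice_def)
  then obtain m where "m \<in> A" using p(2) by fastforce
  then have "mono_dvd m p" "monom_poly m \<in> M"
    using A dvd_mono_lcm[OF finite_subset[OF A(1) finite_min_gens]] by (auto simp: min_gens_def)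
  then show ?thesis using monomial_ideal_dvd[OF M] by blast
qed

lemma lcm_below_in_ideal:
  fixes M :: "('x::finite, 'k::field) mpoly set"
  assumes M: "monomial_ideal M" and a: "monom_poly a \<in> M"
  shows "monom_poly (lcm_below M a) \<in> M"
proof -
  obtain n where n: "n \<in> min_gens M" "mono_dvd n a" using ex_min_gens_dvd[OF a] by blast
  then have "monom_poly n \<in> M" by (simp add: min_gens_def)
  then show ?thesis using min_gens_dvd_lcm_below[OF n] by (rule monomial_ideal_dvd[OF M])
qed

section \<open>The Betti poset\<close>

lemma coset_eq_self_iff:
  fixes B :: "'a::ab_group_add set"
  assumes zero: "0 \<in> B" and diff: "\<And>x y. x \<in> B \<Longrightarrow> y \<in> B \<Longrightarrow> x - y \<in> B"
  shows "coset B z = B \<longleftrightarrow> z \<in> B"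
proof
  assume "coset B z = B"
  moreover have "z \<in> coset B z" unfolding coset_def using zero by force
  ultimately show "z \<in> B" by simp
next
  assume z: "z \<in> B"
  have "z + b \<in> B" if "b \<in> B" for b
    using diff[OF z diff[OF zero that]] by simp
  moreover have "b \<in> (\<lambda>b. z + b) ` B" if "b \<in> B" for b
    using diff[OF that z] by (intro image_eqI[of _ _ "b - z"]) auto
  ultimately show "coset B z = B" unfolding coset_def by blast
qed

lemma coset_UNIV [simp]: "coset UNIV z = (UNIV :: 'a::ab_group_add set)"
  by (simp add: coset_eq_self_iff)

lemma coset_monomial_ideal_eq_iff:
  fixes M :: "('x, 'k::field) mpoly set"
  assumes "monomial_ideal M"
  shows "coset M p = M \<longleftrightarrow> p \<in> M"
  by (rule coset_eq_self_iff)
    (use subspace_monomial_ideal[OF assms] in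
      \<open>auto intro: mpoly_module.subspace_0 mpoly_module.subspace_diff\<close>)

lemma cycles_subset_boundaries_if_homology_trivial:
  assumes "reduced_homology lt K i = {simplicial_boundaries lt K i :: ('a set \<Rightarrow>\<^sub>0 'k::field) set}"
  shows "simplicial_cycles lt K i \<subseteq> (simplicial_boundaries lt K i :: ('a set \<Rightarrow>\<^sub>0 'k) set)"
proof
  let ?bs = "simplicial_boundaries lt K i :: ('a set \<Rightarrow>\<^sub>0 'k) set"
  have diff: "x - y \<in> ?bs" if xy: "x \<in> ?bs" "y \<in> ?bs" for x y
  proof -
    obtain u v where "x = simplicial_boundary lt u" "u \<in> simplicial_chains K (i + 1)"
        "y = simplicial_boundary lt v" "v \<in> simplicial_chains K (i + 1)"
      using xy unfolding simplicial_boundaries_def by blast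
    moreover from this have "u - v \<in> simplicial_chains K (i + 1)"
      using keys_diff[of u v] unfolding simplicial_chains_def by blast
    ultimately show ?thesis
      unfolding simplicial_boundaries_def
      by (intro image_eqI[of _ _ "u - v"])
        (simp_all add: module_hom.diff[OF linear_map_simplicial_boundary])
  qed
  have zero: "0 \<in> ?bs"
    unfolding simplicial_boundaries_def simplicial_chains_def
    by (rule image_eqI[where x = 0])
      (simp_all add: linear_map_zero[OF linear_map_simplicial_boundary])
  fix z :: "'a set \<Rightarrow>\<^sub>0 'k" assume "z \<in> simplicial_cycles lt K i"
  then have "coset ?bs z = ?bs" using assms unfolding reduced_homology_def quot_def by blast
  then show "z \<in> ?bs" using coset_eq_self_iff[OF zero diff] by blast
qed

lemma (in ordering) exact_on_faces_if_homology_trivial: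
  assumes "\<And>i. reduced_homology (\<^bold><) (order_complex (\<^bold>\<le>) A) i
    = {simplicial_boundaries (\<^bold><) (order_complex (\<^bold>\<le>) A) i :: ('a set \<Rightarrow>\<^sub>0 'k::field) set}"
  shows "exact_on (\<lambda>_. bd :: ('a set \<Rightarrow>\<^sub>0 'k) \<Rightarrow> _) (faces A)"
  unfolding exact_on_def exact_at_def
proof (intro allI ballI)
  fix i and z :: "'a set \<Rightarrow>\<^sub>0 'k" assume z: "z \<in> cycles (\<lambda>_. bd) (faces A) i"
  let ?K = "order_complex (\<^bold>\<le>) A"
  have "z \<in> simplicial_cycles (\<^bold><) ?K (int i - 1)"
    using z by (auto simp: cycles_faces_iff simplicial_cycles_def simplicial_chains_def)
  then have "z \<in> simplicial_boundaries (\<^bold><) ?K (int i - 1)"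
    using cycles_subset_boundaries_if_homology_trivial[OF assms] by blast
  then obtain u where u: "z = bd u" "keys u \<subseteq> {\<sigma> \<in> ?K. int (card \<sigma>) = int i + 1}"
    by (auto simp: simplicial_boundaries_def simplicial_chains_def)
  have "int (card \<sigma>) = int i + 1 \<longleftrightarrow> card \<sigma> = Suc i" for \<sigma> :: "'a set" by linarith
  then show "\<exists>w. keys w \<subseteq> faces A (Suc i) \<and> bd w = z" using u by auto
qed

definition open_interval :: "('x::finite, 'k::field) mpoly set \<Rightarrow> 'x mono \<Rightarrow> 'x mono set" where
  "open_interval M p = {q \<in> lcm_lattice M. mono_sdvd 0 q \<and> mono_sdvd q p}"

lemma exact_on_faces_if_notin_betti_poset:
  fixes M :: "('x::finite, 'k::field) mpoly set"
  assumes "p \<in> lcm_lattice M" "p \<notin> betti_poset M"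
  shows "exact_on (\<lambda>_. simplicial_boundary mono_sdvd :: ('x mono set \<Rightarrow>\<^sub>0 'k) \<Rightarrow> _)
    (mono_ord.faces (open_interval M p))"
  by (rule mono_ord.exact_on_faces_if_homology_trivial)
    (use assms in \<open>auto simp: betti_poset_def lower_complex_def open_interval_def\<close>)

lemma zero_in_betti_poset: "0 \<in> betti_poset (M :: ('x::finite, 'k::field) mpoly set)"
proof (rule ccontr)
  assume "0 \<notin> betti_poset M"
  then have "exact_on (\<lambda>_. simplicial_boundary mono_sdvd :: ('x mono set \<Rightarrow>\<^sub>0 'k) \<Rightarrow> _)
      (mono_ord.faces (open_interval M 0))"
    by (intro exact_on_faces_if_notin_betti_poset zero_in_lcm_lattice)
  moreover have "open_interval M 0 = {}" by (auto simp: open_interval_def mono_sdvd_def)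
  ultimately have exact: "exact_on (\<lambda>_. simplicial_boundary mono_sdvd :: ('x mono set \<Rightarrow>\<^sub>0 'k) \<Rightarrow> _)
      (mono_ord.faces {})"
    by simp
  have "single {} 1 \<in> cycles (\<lambda>_. simplicial_boundary mono_sdvd) (mono_ord.faces {}) 0"
    by (simp add: cycles_def order_complex_def)
  with exact obtain w :: "'x mono set \<Rightarrow>\<^sub>0 'k" where
    w: "keys w \<subseteq> mono_ord.faces {} (Suc 0)" "simplicial_boundary mono_sdvd w = single {} 1"
    by (rule exact_onE)
  then have "w = 0" by (auto simp: order_complex_def simp flip: keys_eq_empty)
  then have "single {} (1 :: 'k) = (0 :: 'x mono set \<Rightarrow>\<^sub>0 'k)"
    using w(2) by (simp add: linear_map_zero[OF linear_map_simplicial_boundary])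
  then show False by (simp flip: keys_eq_empty)
qed

section \<open>Labelled frames\<close>

locale frame =
  fixes B :: "nat \<Rightarrow> 'b set" and c :: "nat \<Rightarrow> 'b \<Rightarrow> 'b \<Rightarrow> 'k::field" and e0 :: 'b
  assumes finite_B: "finite (B i)"
    and B_0: "B 0 = {e0}"
    and diff_diff: "keys v \<subseteq> B (Suc (Suc i)) \<Longrightarrow>
      matrix_diff B c (Suc i) (matrix_diff B c (Suc (Suc i)) v) = 0"
begin

abbreviation diff :: "nat \<Rightarrow> ('b \<Rightarrow>\<^sub>0 'k) \<Rightarrow> ('b \<Rightarrow>\<^sub>0 'k)" where
  "diff \<equiv> matrix_diff B c"

lemma keys_diff_single_subset:
  assumes "e \<in> B (Suc i)" and T: "\<And>e'. e' \<in> B i \<Longrightarrow> c (Suc i) e e' \<noteq> 0 \<Longrightarrow> e' \<in> T"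
  shows "keys (diff (Suc i) (single e r)) \<subseteq> T"
proof
  fix e' assume "e' \<in> keys (diff (Suc i) (single e r))"
  then have "e' \<in> B i" "r * c (Suc i) e e' \<noteq> 0"
    by (auto simp: in_keys_iff lookup_matrix_diff_single[of B, OF finite_B finite_B assms(1)]
        split: if_splits)
  then show "e' \<in> T" using T by auto
qed

end

locale labelled_frame = frame B c e0
  for B :: "nat \<Rightarrow> 'b set" and c :: "nat \<Rightarrow> 'b \<Rightarrow> 'b \<Rightarrow> 'k::field" and e0 :: 'b +
  fixes lab :: "nat \<Rightarrow> 'b \<Rightarrow> 'x::finite mono"
  assumes lab_0: "lab 0 e0 = 0"
    and lab_sdvd: "e \<in> B (Suc i) \<Longrightarrow> e' \<in> B i \<Longrightarrow> c (Suc i) e e' \<noteq> 0 \<Longrightarrow>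
      mono_sdvd (lab i e') (lab (Suc i) e)"
begin

abbreviation weakly_below :: "'x mono \<Rightarrow> nat \<Rightarrow> 'b set" where
  "weakly_below \<equiv> below mono_dvd B lab"

abbreviation strictly_below :: "'x mono \<Rightarrow> nat \<Rightarrow> 'b set" where
  "strictly_below \<equiv> below mono_sdvd B lab"

lemma labelled_resolution_strictly_below:
  fixes N :: "('x, 'k) mpoly set"
  assumes p: "p \<noteq> 0"
    and lab_in: "\<And>i e. e \<in> strictly_below p (Suc i) \<Longrightarrow> lab (Suc i) e \<in> open_interval N p"
    and exact: "\<And>q. q \<in> open_interval N p \<Longrightarrow> exact_on diff (weakly_below q)"
  shows "labelled_resolution mono_dvd 0 (open_interval N p) diff (strictly_below p) lab e0"
proof (intro labelled_resolution.intro labelled_resolution_axioms.intro)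
  show "partial_preordering (mono_dvd :: 'x mono \<Rightarrow> _)" by (rule mono_ord.partial_preordering_axioms)
  show "linear_map (diff i)" for i by (rule linear_map_matrix_diff)
  show "diff (Suc i) (diff (Suc (Suc i)) v) = 0"
    if "keys v \<subseteq> strictly_below p (Suc (Suc i))" for i v
    by (rule diff_diff) (use that in \<open>auto simp: below_def\<close>)
  show "strictly_below p 0 = {e0}"
    using B_0 lab_0 p by (auto simp: below_def mono_sdvd_def)
  show "lab 0 e0 = 0" by (rule lab_0)
  show "lab (Suc i) e \<in> open_interval N p" if "e \<in> strictly_below p (Suc i)" for e i
    by (rule lab_in[OF that])
  show "exact_on diff (below mono_dvd (strictly_below p) lab q)" if q: "q \<in> open_interval N p" for q
  proof -
    have "below mono_dvd (strictly_below p) lab q = weakly_below q"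
      using q mono_ord.strict_trans1[of _ q p] by (auto simp: below_def open_interval_def)
    then show ?thesis using exact[OF q] by simp
  qed
  show "keys (diff (Suc i) (single e 1)) \<subseteq> below mono_dvd (strictly_below p) lab (lab (Suc i) e) i"
    if e: "e \<in> strictly_below p (Suc i)" for e i
  proof (rule keys_diff_single_subset)
    show "e \<in> B (Suc i)" using e by (simp add: below_def)
    fix e' assume e': "e' \<in> B i" "c (Suc i) e e' \<noteq> 0"
    have "mono_sdvd (lab i e') (lab (Suc i) e)"
      using e by (intro lab_sdvd[OF _ e']) (simp add: below_def)
    then show "e' \<in> below mono_dvd (strictly_below p) lab (lab (Suc i) e) i"
      using e e'(1) mono_ord.strict_trans by (auto simp: below_def mono_ord.strict_implies_order)
  qed
qed

lemma exact_strictly_below_if_notin_betti_poset: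
  fixes N :: "('x, 'k) mpoly set"
  assumes p: "p \<in> lcm_lattice N" "p \<notin> betti_poset N" "p \<noteq> 0"
    and lab_in: "\<And>i e. e \<in> strictly_below p (Suc i) \<Longrightarrow> lab (Suc i) e \<in> open_interval N p"
    and exact: "\<And>q. q \<in> open_interval N p \<Longrightarrow> exact_on diff (weakly_below q)"
  shows "exact_on diff (strictly_below p)"
proof -
  let ?chains = "\<lambda>_. simplicial_boundary mono_sdvd :: ('x mono set \<Rightarrow>\<^sub>0 'k) \<Rightarrow> _"
  let ?Q = "open_interval N p"
  have "labelled_resolution mono_dvd 0 ?Q diff (strictly_below p) lab e0"
    by (rule labelled_resolution_strictly_below[OF p(3) lab_in exact])
  moreover have "labelled_resolution mono_dvd 0 ?Q
      ?chains (mono_ord.faces ?Q) (\<lambda>_. mono_ord.top_vertex 0) {}"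
    by (rule mono_ord.labelled_resolution_faces) simp
  ultimately have "labelled_resolution_pair mono_dvd 0 ?Q diff (strictly_below p) lab e0
      ?chains (mono_ord.faces ?Q) (\<lambda>_. mono_ord.top_vertex 0) {}"
    by (rule labelled_resolution_pair.intro)
  moreover have "exact_on ?chains (mono_ord.faces ?Q)"
    by (rule exact_on_faces_if_notin_betti_poset[OF p(1,2)])
  ultimately show ?thesis by (rule labelled_resolution_pair.exact_on_transfer)
qed

end

locale resolution_frame = labelled_frame B c e0 lab
  for B :: "nat \<Rightarrow> 'b set" and c :: "nat \<Rightarrow> 'b \<Rightarrow> 'b \<Rightarrow> 'k::field" and e0 :: 'b
    and lab :: "nat \<Rightarrow> 'b \<Rightarrow> 'x::finite mono" +
  fixes M :: "('x, 'k) mpoly set"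
  assumes M: "monomial_ideal M" and M_proper: "M \<noteq> UNIV"
    and lab_in_ideal: "e \<in> B (Suc i) \<Longrightarrow> monom_poly (lab (Suc i) e) \<in> M"
    and exact: "monom_poly a \<in> M \<Longrightarrow> exact_on diff (weakly_below a)"
begin

lemma lab_nonzero: "e \<in> B (Suc i) \<Longrightarrow> lab (Suc i) e \<noteq> 0"
  using lab_in_ideal monomial_ideal_one_iff[OF M] M_proper by metis

text \<open>
  Otherwise \<open>e - w\<close> would be a boundary, but by minimality \<open>e\<close> occurs in no boundary below its
  label.
\<close>

lemma diff_single_neq_strictly_below:
  assumes e: "e \<in> B (Suc i)" and w: "keys w \<subseteq> strictly_below (lab (Suc i) e) (Suc i)"
  shows "diff (Suc i) w \<noteq> diff (Suc i) (single e 1)"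
proof
  assume dw: "diff (Suc i) w = diff (Suc i) (single e 1)"
  define a where "a = lab (Suc i) e"
  have "keys w \<subseteq> weakly_below a (Suc i)" and we: "lookup w e = 0"
    using w by (auto simp: below_def a_def mono_sdvd_def in_keys_iff)
  moreover have "keys (single e (1 :: 'k)) \<subseteq> weakly_below a (Suc i)"
    using e mono_ord.refl by (simp add: below_def a_def)
  ultimately have "keys (single e 1 - w) \<subseteq> weakly_below a (Suc i)"
    by (meson subset_trans[OF keys_diff Un_least])
  then have "single e 1 - w \<in> cycles diff (weakly_below a) (Suc i)"
    using dw by (simp add: cycles_def module_hom.diff[OF linear_map_matrix_diff])
  then obtain u where u: "keys u \<subseteq> weakly_below a (Suc (Suc i))"
      "diff (Suc (Suc i)) u = single e 1 - w"
    using exact_onE[OF exact[OF lab_in_ideal[OF e]]] unfolding a_def by blast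
  have "keys (diff (Suc (Suc i)) u) \<subseteq> - {e}"
  proof (rule keys_linear_map_subset[OF linear_map_matrix_diff])
    fix f assume "f \<in> keys u"
    then have f: "f \<in> B (Suc (Suc i))" "mono_dvd (lab (Suc (Suc i)) f) a"
      using u(1) by (auto simp: below_def)
    show "keys (diff (Suc (Suc i)) (single f 1)) \<subseteq> - {e}"
      by (rule keys_diff_single_subset[OF f(1)])
        (use lab_sdvd[OF f(1)] f(2) in \<open>auto simp: a_def mono_sdvd_def dest: mono_ord.antisym\<close>)
  qed
  then have "lookup (single e 1 - w) e = 0" unfolding u(2) by (auto simp: in_keys_iff)
  then show False by (simp add: lookup_minus we)
qed

lemma not_exact_strictly_below_label:
  assumes e: "e \<in> B (Suc i)"
    and S: "\<And>j. S j \<subseteq> strictly_below (lab (Suc i) e) j" "strictly_below (lab (Suc i) e) i \<subseteq> S i"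
  shows "\<not> exact_on diff S"
proof
  assume "exact_on diff S"
  moreover have "diff (Suc i) (single e 1) \<in> cycles diff S i"
  proof -
    have "keys (diff (Suc i) (single e 1)) \<subseteq> strictly_below (lab (Suc i) e) i"
      by (rule keys_diff_single_subset[OF e]) (use lab_sdvd[OF e] in \<open>simp add: below_def\<close>)
    moreover have "i = 0 \<or> diff i (diff (Suc i) (single e 1)) = 0"
      using diff_diff[of "single e 1"] e by (cases i) auto
    ultimately show ?thesis using S(2) by (auto simp: cycles_def)
  qed
  ultimately obtain w where "keys w \<subseteq> S (Suc i)" "diff (Suc i) w = diff (Suc i) (single e 1)"
    by (rule exact_onE)
  then show False using diff_single_neq_strictly_below[OF e] S(1)[of "Suc i"] by blast
qed

lemma label_in_lcm_lattice: "e \<in> B i \<Longrightarrow> lab i e \<in> lcm_lattice M"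
proof (induction "lab i e" arbitrary: i e rule: wfp_induct_rule[OF wfp_mono_sdvd])
  case 1
  show ?case
  proof (cases i)
    case 0
    then show ?thesis using 1(2) B_0 lab_0 zero_in_lcm_lattice[of M] by simp
  next
    case (Suc j)
    define a where "a = lab (Suc j) e"
    define b where "b = lcm_below M a"
    have e: "e \<in> B (Suc j)" using 1(2) Suc by simp
    have sub: "strictly_below a k \<subseteq> weakly_below b k" for k
      using 1(1) dvd_lcm_below_iff[of _ M] mono_ord.strict_implies_order
      by (auto simp: below_def a_def b_def Suc)
    have exact_b: "exact_on diff (weakly_below b)"
      using lab_in_ideal[OF e] unfolding a_def b_def by (intro exact lcm_below_in_ideal[OF M])
    have "b = a"
    proof (rule ccontr)
      assume "b \<noteq> a"
      then have "mono_sdvd b a" using lcm_below_dvd[of M a] by (simp add: b_def mono_sdvd_def)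
      then have "weakly_below b k \<subseteq> strictly_below a k" for k
        using mono_ord.strict_trans1 by (auto simp: below_def)
      then show False using not_exact_strictly_below_label[OF e, of "weakly_below b"] sub exact_b
        unfolding a_def by blast
    qed
    then show ?thesis using lcm_below_in_lcm_lattice[of M a] by (simp add: a_def b_def Suc)
  qed
qed

lemma label_in_betti_poset:
  assumes "e \<in> B i"
  shows "lab i e \<in> betti_poset M"
proof (cases i)
  case 0
  then show ?thesis using assms B_0 lab_0 zero_in_betti_poset[of M] by simp
next
  case (Suc j)
  have e: "e \<in> B (Suc j)" using assms Suc by simp
  show ?thesis
  proof (rule ccontr)
    assume "lab i e \<notin> betti_poset M"
    then have "exact_on diff (strictly_below (lab (Suc j) e))"
    proof (intro exact_strictly_below_if_notin_betti_poset)
      show "lab (Suc j) e \<in> lcm_lattice M" by (rule label_in_lcm_lattice[OF e])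
      show "lab (Suc j) e \<noteq> 0" by (rule lab_nonzero[OF e])
      show "lab (Suc k) f \<in> open_interval M (lab (Suc j) e)"
        if "f \<in> strictly_below (lab (Suc j) e) (Suc k)" for f k
        using that label_in_lcm_lattice[of f "Suc k"] lab_nonzero[of f k]
        by (auto simp: below_def open_interval_def mono_sdvd_def)
      show "exact_on diff (weakly_below q)" if "q \<in> open_interval M (lab (Suc j) e)" for q
        using that lcm_lattice_in_ideal[OF M, of q]
        by (intro exact) (auto simp: open_interval_def mono_sdvd_def)
    qed (simp add: Suc)
    then show False using not_exact_strictly_below_label[OF e] by blast
  qed
qed

end

lemma (in labelled_frame) exact_on_lcm_lattice_if_exact_on_betti_poset:
  fixes N :: "('x, 'k) mpoly set"
  assumes lab_in: "\<And>i e. e \<in> B i \<Longrightarrow> lab i e \<in> betti_poset N"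
    and lab_nonzero: "\<And>i e. e \<in> B (Suc i) \<Longrightarrow> lab (Suc i) e \<noteq> 0"
    and exact: "\<And>q. q \<in> betti_poset N \<Longrightarrow> q \<noteq> 0 \<Longrightarrow> exact_on diff (weakly_below q)"
  shows "q \<in> lcm_lattice N \<Longrightarrow> q \<noteq> 0 \<Longrightarrow> exact_on diff (weakly_below q)"
proof (induction q rule: wfp_induct_rule[OF wfp_mono_sdvd])
  case (1 q)
  show ?case
  proof (cases "q \<in> betti_poset N")
    case True
    then show ?thesis using 1(3) by (rule exact)
  next
    case False
    have "exact_on diff (strictly_below q)"
    proof (rule exact_strictly_below_if_notin_betti_poset[OF 1(2) False 1(3)])
      show "lab (Suc i) e \<in> open_interval N q" if "e \<in> strictly_below q (Suc i)" for i e
        using that lab_in[of e "Suc i"] lab_nonzero[of e i]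
        by (auto simp: below_def open_interval_def mono_sdvd_def betti_poset_def)
      show "exact_on diff (weakly_below r)" if "r \<in> open_interval N q" for r
        using that by (intro 1(1)) (auto simp: open_interval_def mono_sdvd_def)
    qed
    moreover have "strictly_below q = weakly_below q"
      using lab_in False by (auto simp: below_def fun_eq_iff mono_sdvd_def)
    ultimately show ?thesis by simp
  qed
qed

lemma (in labelled_frame) resolution_frame_if_exact_on_betti_poset:
  fixes N :: "('x, 'k) mpoly set"
  assumes N: "monomial_ideal N" "N \<noteq> UNIV"
    and lab_in: "\<And>i e. e \<in> B i \<Longrightarrow> lab i e \<in> betti_poset N"
    and lab_nonzero: "\<And>i e. e \<in> B (Suc i) \<Longrightarrow> lab (Suc i) e \<noteq> 0"
    and exact: "\<And>q. q \<in> betti_poset N \<Longrightarrow> q \<noteq> 0 \<Longrightarrow> exact_on diff (weakly_below q)"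
  shows "resolution_frame B c e0 lab N"
proof unfold_locales
  have lab_L: "lab i e \<in> lcm_lattice N" if "e \<in> B i" for i e
    using lab_in[OF that] by (simp add: betti_poset_def)
  show "monomial_ideal N" "N \<noteq> UNIV" by (fact N)+
  show "monom_poly (lab (Suc i) e) \<in> N" if "e \<in> B (Suc i)" for i e
    by (rule lcm_lattice_in_ideal[OF N(1) lab_L[OF that] lab_nonzero[OF that]])
  show "exact_on diff (weakly_below a)" if a: "monom_poly a \<in> N" for a
  proof -
    have "lcm_below N a \<noteq> 0"
      using lcm_below_in_ideal[OF N(1) a] monomial_ideal_one_iff[OF N(1)] N(2) by metis
    then have "exact_on diff (weakly_below (lcm_below N a))"
      using exact_on_lcm_lattice_if_exact_on_betti_poset[OF lab_in lab_nonzero exact]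
        lcm_below_in_lcm_lattice[of N a]
      by blast
    moreover have "weakly_below (lcm_below N a) = weakly_below a"
      using dvd_lcm_below_iff[OF lab_L] by (auto simp: below_def fun_eq_iff)
    ultimately show ?thesis by simp
  qed
qed

section \<open>Relabeling frames along isomorphisms of Betti posets\<close>

lemma poset_iso_mono_sdvd_iff:
  assumes "poset_iso mono_dvd A mono_dvd A' g" "p \<in> A" "q \<in> A"
  shows "mono_sdvd (g p) (g q) \<longleftrightarrow> mono_sdvd p q"
  using assms by (auto simp: poset_iso_def mono_sdvd_def bij_betw_def inj_on_eq_iff)

lemma poset_iso_betti_poset_zero:
  assumes g: "poset_iso mono_dvd (betti_poset M) mono_dvd (betti_poset N) g"
  shows "g 0 = 0"
proof -
  obtain q where q: "q \<in> betti_poset M" "g q = 0"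
    using g zero_in_betti_poset[of N] by (metis poset_iso_def bij_betw_iff_bijections)
  have "mono_dvd 0 q \<longleftrightarrow> mono_dvd (g 0) (g q)"
    using g zero_in_betti_poset[of M] q(1) unfolding poset_iso_def by blast
  then show ?thesis by (simp add: q(2))
qed

lemma (in resolution_frame) resolution_frame_relabel:
  fixes N :: "('y::finite, 'k) mpoly set"
  assumes N: "monomial_ideal N" "N \<noteq> UNIV"
    and g: "poset_iso mono_dvd (betti_poset M) mono_dvd (betti_poset N) g"
  shows "resolution_frame B c e0 (\<lambda>i e. g (lab i e)) N"
proof -
  note g_sdvd = poset_iso_mono_sdvd_iff[OF g]
  note g_0 = poset_iso_betti_poset_zero[OF g]
  interpret relabelled: labelled_frame B c e0 "\<lambda>i e. g (lab i e)"
    by unfold_locales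
      (simp_all add: lab_0 g_0 g_sdvd label_in_betti_poset lab_sdvd)
  show ?thesis
  proof (rule relabelled.resolution_frame_if_exact_on_betti_poset[OF N])
    show "g (lab i e) \<in> betti_poset N" if "e \<in> B i" for i e
      using g label_in_betti_poset[OF that] by (auto simp: poset_iso_def dest: bij_betwE)
    show "g (lab (Suc i) e) \<noteq> 0" if e: "e \<in> B (Suc i)" for i e
      using g_sdvd[OF zero_in_betti_poset label_in_betti_poset[OF e]] lab_nonzero[OF e] g_0
      by (auto simp: mono_sdvd_def)
  next
    fix q assume q: "q \<in> betti_poset N" "q \<noteq> 0"
    then obtain p where p: "p \<in> betti_poset M" "q = g p"
      using g by (metis poset_iso_def bij_betw_iff_bijections)
    then have "exact_on diff (weakly_below p)"
      using q(2) g_0 by (intro exact lcm_lattice_in_ideal[OF M]) (auto simp: betti_poset_def)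
    moreover have "relabelled.weakly_below q = weakly_below p"
      using g p label_in_betti_poset by (auto simp: below_def fun_eq_iff poset_iso_def)
    ultimately show "exact_on diff (relabelled.weakly_below q)" by simp
  qed
qed

section \<open>Homogenization\<close>

lemma differential_eq_matrix_diff: "differential G = matrix_diff (basis G) (entry G)"
  by (simp add: fun_eq_iff differential_def matrix_diff_def)

abbreviation kernel ::
    "('b, 'x, 'k::field) based_seq \<Rightarrow> nat \<Rightarrow> ('b \<Rightarrow>\<^sub>0 ('x, 'k) mpoly) set" where
  "kernel G i \<equiv> {V \<in> free_mod G i. differential G i V = 0}"

abbreviation boundaries ::
    "('b, 'x, 'k::field) based_seq \<Rightarrow> nat \<Rightarrow> ('b \<Rightarrow>\<^sub>0 ('x, 'k) mpoly) set" where
  "boundaries G i \<equiv> differential G (Suc i) ` free_mod G (Suc i)"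

locale homogenization =
  fixes G :: "('b, 'x::finite, 'k::field) based_seq" and lab :: "nat \<Rightarrow> 'b \<Rightarrow> 'x mono"
    and c :: "nat \<Rightarrow> 'b \<Rightarrow> 'b \<Rightarrow> 'k"
  assumes finite_basis: "finite (basis G i)"
    and mdeg_eq: "e \<in> basis G i \<Longrightarrow> mdeg G i e = (\<lambda>x. int (lookup (lab i e) x))"
    and entry_eq: "e \<in> basis G (Suc i) \<Longrightarrow> e' \<in> basis G i \<Longrightarrow>
      entry G (Suc i) e e' = single (lab (Suc i) e - lab i e') (c (Suc i) e e')"
    and c_dvd: "e \<in> basis G (Suc i) \<Longrightarrow> e' \<in> basis G i \<Longrightarrow> c (Suc i) e e' \<noteq> 0 \<Longrightarrow>
      mono_dvd (lab i e') (lab (Suc i) e)"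
begin

abbreviation diff :: "nat \<Rightarrow> ('b \<Rightarrow>\<^sub>0 'k) \<Rightarrow> ('b \<Rightarrow>\<^sub>0 'k)" where
  "diff \<equiv> matrix_diff (basis G) c"

abbreviation weakly_below :: "'x mono \<Rightarrow> nat \<Rightarrow> 'b set" where
  "weakly_below \<equiv> below mono_dvd (basis G) lab"

definition strand :: "nat \<Rightarrow> 'x mono \<Rightarrow> ('b \<Rightarrow>\<^sub>0 ('x, 'k) mpoly) \<Rightarrow> ('b \<Rightarrow>\<^sub>0 'k)" where
  "strand i a V = (\<Sum>e\<in>weakly_below a i. single e (lookup (lookup V e) (a - lab i e)))"

definition lift :: "nat \<Rightarrow> 'x mono \<Rightarrow> ('b \<Rightarrow>\<^sub>0 'k) \<Rightarrow> ('b \<Rightarrow>\<^sub>0 ('x, 'k) mpoly)" where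
  "lift i a v = (\<Sum>e\<in>basis G i. single e (single (a - lab i e) (lookup v e)))"

lemma graded_free_seq: "graded_free_seq G"
  unfolding graded_free_seq_def
proof (intro conjI allI ballI)
  show "finite (basis G i)" for i by (rule finite_basis)
  fix i e e' assume e: "e \<in> basis G (Suc i)" and e': "e' \<in> basis G i"
  show "homogeneous (\<lambda>x. mdeg G (Suc i) e x - mdeg G i e' x) (entry G (Suc i) e e')"
  proof (cases "c (Suc i) e e' = 0")
    case True
    then show ?thesis by (simp add: homogeneous_def entry_eq[OF e e'])
  next
    case False
    then show ?thesis
      using c_dvd[OF e e' False]
      by (simp add: homogeneous_def entry_eq[OF e e'] mdeg_eq[OF e] mdeg_eq[OF e']
          lookup_minus mono_dvd_def of_nat_diff)
  qed
qed

lemma lookup_strand: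
  "lookup (strand i a V) e
    = (if e \<in> weakly_below a i then lookup (lookup V e) (a - lab i e) else 0)"
proof -
  have "finite (weakly_below a i)" using finite_basis by (simp add: below_def)
  then show ?thesis by (simp add: strand_def lookup_sum lookup_single when_def)
qed

lemma keys_strand: "keys (strand i a V) \<subseteq> weakly_below a i"
  by (auto simp: in_keys_iff lookup_strand split: if_splits)

lemma additive_strand: "additive (strand i a)"
  by (simp add: additive_def strand_def lookup_add single_add sum.distrib)

lemma lookup_lift:
  "lookup (lift i a v) e = (if e \<in> basis G i then single (a - lab i e) (lookup v e) else 0)"
  using finite_basis by (simp add: lift_def lookup_sum lookup_single when_def)

lemma lift_in_free_mod: "lift i a v \<in> free_mod G i"
  by (auto simp: free_mod_def in_keys_iff lookup_lift split: if_splits)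

lemma strand_lift:
  assumes v: "keys v \<subseteq> weakly_below b i"
  shows "strand i a (lift i b v) = (if a = b then v else 0)"
proof (rule poly_mapping_eqI)
  fix e
  show "lookup (strand i a (lift i b v)) e = lookup (if a = b then v else 0) e"
  proof (cases "e \<in> weakly_below b i")
    case False
    then have "lookup v e = 0" using v by (auto simp: in_keys_iff)
    then show ?thesis by (auto simp: lookup_strand lookup_lift)
  next
    case True
    have "b - lab i e = a - lab i e \<longleftrightarrow> a = b" if "mono_dvd (lab i e) a"
      using that True mono_dvd_diff_add[of "lab i e" a] mono_dvd_diff_add[of "lab i e" b]
      by (auto simp: below_def)
    then show ?thesis
      using True by (auto simp: below_def lookup_strand lookup_lift lookup_single when_def)
  qed
qed

lemma strand_eqI:
  assumes "V \<in> free_mod G i" "W \<in> free_mod G i" "\<And>a. strand i a V = strand i a W"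
  shows "V = W"
proof (intro poly_mapping_eqI)
  fix e m
  show "lookup (lookup V e) m = lookup (lookup W e) m"
  proof (cases "e \<in> basis G i")
    case True
    have "lookup (strand i (m + lab i e) V) e = lookup (strand i (m + lab i e) W) e"
      using assms(3) by simp
    then show ?thesis using True by (simp add: lookup_strand below_def mono_dvd_add)
  next
    case False
    then have "e \<notin> keys V" "e \<notin> keys W" using assms by (auto simp: free_mod_def)
    then show ?thesis by (simp add: in_keys_iff)
  qed
qed

lemma finite_strands: "finite {a. strand i a V \<noteq> 0}"
proof (rule finite_subset)
  show "{a. strand i a V \<noteq> 0} \<subseteq> (\<Union>e\<in>basis G i. (\<lambda>m. m + lab i e) ` keys (lookup V e))"
  proof
    fix a assume "a \<in> {a. strand i a V \<noteq> 0}"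
    then have "keys (strand i a V) \<noteq> {}" by simp
    then obtain e where "e \<in> keys (strand i a V)" by blast
    then have e: "e \<in> basis G i" "mono_dvd (lab i e) a" "a - lab i e \<in> keys (lookup V e)"
      by (auto simp: lookup_strand below_def in_keys_iff split: if_splits)
    then have "a = a - lab i e + lab i e" by (simp add: mono_dvd_diff_add)
    then show "a \<in> (\<Union>e\<in>basis G i. (\<lambda>m. m + lab i e) ` keys (lookup V e))" using e by blast
  qed
qed (use finite_basis in auto)

lemma ex_free_mod_strands:
  assumes w: "\<And>a. keys (w a) \<subseteq> weakly_below a i" and fin: "finite {a. w a \<noteq> 0}"
  shows "\<exists>W\<in>free_mod G i. \<forall>a. strand i a W = w a"
proof
  define W where "W = (\<Sum>a | w a \<noteq> 0. lift i a (w a))"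
  have "keys (lift i a (w a)) \<subseteq> basis G i" for a
    using lift_in_free_mod[of i a "w a"] by (simp add: free_mod_def)
  then show "W \<in> free_mod G i"
    unfolding W_def free_mod_def mem_Collect_eq by (intro keys_sum_subset)
  have "strand i b W = (\<Sum>a | w a \<noteq> 0. if b = a then w a else 0)" for b
    by (simp add: W_def additive.sum[OF additive_strand] strand_lift[OF w])
  then show "\<forall>a. strand i a W = w a" using fin by simp
qed

lemma lookup_times_entry:
  assumes e: "e \<in> basis G (Suc i)" and e': "e' \<in> basis G i" and a: "mono_dvd (lab i e') a"
  shows "lookup (p * entry G (Suc i) e e') (a - lab i e')
    = (if mono_dvd (lab (Suc i) e) a then lookup p (a - lab (Suc i) e) * c (Suc i) e e' else 0)"
proof (cases "c (Suc i) e e' = 0")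
  case True
  then show ?thesis by (simp add: entry_eq[OF e e'])
next
  case False
  note dvd = c_dvd[OF e e' False]
  show ?thesis
    by (simp add: entry_eq[OF e e'] lookup_times_single
        mono_dvd_diff_iff[OF dvd a] mono_diff_diff[OF dvd])
qed

lemma strand_differential:
  "strand i a (differential G (Suc i) V) = diff (Suc i) (strand (Suc i) a V)"
proof (rule poly_mapping_eqI)
  fix e'
  show "lookup (strand i a (differential G (Suc i) V)) e'
      = lookup (diff (Suc i) (strand (Suc i) a V)) e'"
  proof (cases "e' \<in> weakly_below a i")
    case True
    then have e': "e' \<in> basis G i" and dvd: "mono_dvd (lab i e') a" by (simp_all add: below_def)
    have "lookup (strand i a (differential G (Suc i) V)) e'
        = (\<Sum>e\<in>basis G (Suc i). lookup (lookup V e * entry G (Suc i) e e') (a - lab i e'))"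
      using True e' finite_basis
      by (simp add: lookup_strand differential_eq_matrix_diff lookup_matrix_diff lookup_sum)
    also have "\<dots> = (\<Sum>e\<in>basis G (Suc i). lookup (strand (Suc i) a V) e * c (Suc i) e e')"
      by (rule sum.cong) (simp_all add: lookup_times_entry[OF _ e' dvd] lookup_strand below_def)
    finally show ?thesis using e' finite_basis by (simp add: lookup_matrix_diff)
  next
    case False
    have "lookup (strand (Suc i) a V) e * c (Suc i) e e' = 0"
      if "e \<in> basis G (Suc i)" "e' \<in> basis G i" for e
      using that False c_dvd[OF that] mono_ord.trans[of "lab i e'" "lab (Suc i) e" a]
      by (auto simp: lookup_strand below_def)
    then have "lookup (diff (Suc i) (strand (Suc i) a V)) e' = 0"
      using finite_basis by (simp add: lookup_matrix_diff del: mult_eq_0_iff)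
    moreover have "lookup (strand i a (differential G (Suc i) V)) e' = 0"
      using False by (simp add: lookup_strand)
    ultimately show ?thesis by simp
  qed
qed

lemma differential_in_free_mod: "differential G (Suc i) V \<in> free_mod G i"
  using finite_basis
  by (auto simp: free_mod_def in_keys_iff differential_eq_matrix_diff lookup_matrix_diff
      split: if_splits)

lemma differential_eq_0_iff:
  "differential G (Suc i) V = 0 \<longleftrightarrow> (\<forall>a. diff (Suc i) (strand (Suc i) a V) = 0)"
proof -
  have zero: "strand i a 0 = 0" for a by (rule additive.zero[OF additive_strand])
  have "0 \<in> free_mod G i" by (simp add: free_mod_def)
  from strand_eqI[OF differential_in_free_mod this, of V] show ?thesis
    by (auto simp: strand_differential[symmetric] zero)
qed

lemma mem_boundaries_iff:
  assumes V: "V \<in> free_mod G i"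
  shows "V \<in> boundaries G i \<longleftrightarrow>
    (\<forall>a. \<exists>w. keys w \<subseteq> weakly_below a (Suc i) \<and> diff (Suc i) w = strand i a V)" (is "_ \<longleftrightarrow> ?strands")
proof
  assume "V \<in> boundaries G i"
  then show ?strands using strand_differential keys_strand by (metis imageE)
next
  assume ?strands
  then obtain w where w: "\<And>a. keys (w a) \<subseteq> weakly_below a (Suc i)"
      "\<And>a. diff (Suc i) (w a) = strand i a V"
    by metis
  define w' where "w' a = (if strand i a V = 0 then 0 else w a)" for a
  have "finite {a. w' a \<noteq> 0}"
    by (rule finite_subset[OF _ finite_strands[of i V]]) (auto simp: w'_def)
  moreover have "keys (w' a) \<subseteq> weakly_below a (Suc i)" for a using w(1) by (simp add: w'_def)
  ultimately obtain W where W: "W \<in> free_mod G (Suc i)" "\<And>a. strand (Suc i) a W = w' a"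
    using ex_free_mod_strands by blast
  have "strand i a (differential G (Suc i) W) = strand i a V" for a
    by (simp add: strand_differential W(2) w'_def w(2) linear_map_zero[OF linear_map_matrix_diff])
  then have "differential G (Suc i) W = V" by (rule strand_eqI[OF differential_in_free_mod V])
  then show "V \<in> boundaries G i" using W(1) by blast
qed

lemma differential_differential_eq_0_iff:
  "(\<forall>V\<in>free_mod G (Suc (Suc i)). differential G (Suc i) (differential G (Suc (Suc i)) V) = 0) \<longleftrightarrow>
    (\<forall>v. keys v \<subseteq> basis G (Suc (Suc i)) \<longrightarrow> diff (Suc i) (diff (Suc (Suc i)) v) = 0)"
proof (intro iffI allI ballI impI)
  fix v :: "'b \<Rightarrow>\<^sub>0 'k"
  assume zero:
      "\<forall>V\<in>free_mod G (Suc (Suc i)). differential G (Suc i) (differential G (Suc (Suc i)) V) = 0"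
    and v: "keys v \<subseteq> basis G (Suc (Suc i))"
  have "diff (Suc i) (diff (Suc (Suc i)) (single e 1)) = 0" if "e \<in> keys v" for e
  proof -
    let ?a = "lab (Suc (Suc i)) e"
    have "keys (single e (1 :: 'k)) \<subseteq> weakly_below ?a (Suc (Suc i))"
      using that v mono_ord.refl by (auto simp: below_def)
    then have "strand (Suc (Suc i)) ?a (lift (Suc (Suc i)) ?a (single e 1)) = single e 1"
      by (simp add: strand_lift)
    then show ?thesis
      using zero[rule_format, OF lift_in_free_mod[of "Suc (Suc i)" ?a "single e 1"]]
      unfolding differential_eq_0_iff strand_differential by metis
  qed
  then show "diff (Suc i) (diff (Suc (Suc i)) v) = 0"
    by (rule linear_map_eqI[OF linear_map_compose[OF linear_map_matrix_diff linear_map_matrix_diff]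
        free_pair.module_hom_zero])
next
  fix V assume zero: "\<forall>v. keys v \<subseteq> basis G (Suc (Suc i)) \<longrightarrow> diff (Suc i) (diff (Suc (Suc i)) v) = 0"
  have "keys (strand (Suc (Suc i)) a V) \<subseteq> basis G (Suc (Suc i))" for a
    using keys_strand[of "Suc (Suc i)" a V] by (auto simp: below_def)
  then show "differential G (Suc i) (differential G (Suc (Suc i)) V) = 0"
    using zero by (simp add: differential_eq_0_iff strand_differential)
qed

lemma kernel_subset_boundaries_iff:
  "kernel G (Suc i) \<subseteq> boundaries G (Suc i)
    \<longleftrightarrow> (\<forall>a. exact_at diff (weakly_below a) (Suc i))"
proof (intro iffI allI subsetI)
  fix a
  assume sub: "kernel G (Suc i) \<subseteq> boundaries G (Suc i)"
  show "exact_at diff (weakly_below a) (Suc i)"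
    unfolding exact_at_def
  proof
    fix z assume "z \<in> cycles diff (weakly_below a) (Suc i)"
    then have z: "keys z \<subseteq> weakly_below a (Suc i)" "diff (Suc i) z = 0"
      by (simp_all add: cycles_def)
    have "differential G (Suc i) (lift (Suc i) a z) = 0"
      by (simp add: differential_eq_0_iff strand_lift[OF z(1)] z(2)
          linear_map_zero[OF linear_map_matrix_diff])
    then have "lift (Suc i) a z \<in> boundaries G (Suc i)"
      using sub lift_in_free_mod by blast
    then show "\<exists>w. keys w \<subseteq> weakly_below a (Suc (Suc i)) \<and> diff (Suc (Suc i)) w = z"
      unfolding mem_boundaries_iff[OF lift_in_free_mod] by (metis strand_lift[OF z(1)])
  qed
next
  fix V
  assume exact: "\<forall>a. exact_at diff (weakly_below a) (Suc i)"
    and V: "V \<in> kernel G (Suc i)"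
  have "strand (Suc i) a V \<in> cycles diff (weakly_below a) (Suc i)" for a
    using V keys_strand by (simp add: cycles_def differential_eq_0_iff)
  then show "V \<in> boundaries G (Suc i)"
    using V exact by (simp add: mem_boundaries_iff exact_at_def)
qed

lemma differential_in_irrelevant_ideal_iff:
  "(\<forall>V\<in>free_mod G (Suc i). \<forall>e'\<in>basis G i. lookup (differential G (Suc i) V) e' \<in> irrelevant_ideal)
    \<longleftrightarrow> (\<forall>e\<in>basis G (Suc i). \<forall>e'\<in>basis G i. c (Suc i) e e' \<noteq> 0 \<longrightarrow>
      mono_sdvd (lab i e') (lab (Suc i) e))"
proof (intro iffI ballI impI)
  fix e e' assume e: "e \<in> basis G (Suc i)" and e': "e' \<in> basis G i" and c: "c (Suc i) e e' \<noteq> 0"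
  assume "\<forall>V\<in>free_mod G (Suc i). \<forall>e'\<in>basis G i.
      lookup (differential G (Suc i) V) e' \<in> irrelevant_ideal"
  moreover have "single e 1 \<in> free_mod G (Suc i)" using e by (simp add: free_mod_def)
  ultimately have "lookup (lookup (differential G (Suc i) (single e 1)) e') 0 = 0"
    using e' by (simp add: irrelevant_ideal_iff)
  then have "lab (Suc i) e - lab i e' \<noteq> 0"
    using c e e' finite_basis
    by (auto simp: differential_eq_matrix_diff lookup_matrix_diff_single entry_eq)
  then show "mono_sdvd (lab i e') (lab (Suc i) e)"
    using c_dvd[OF e e' c] by (auto simp: mono_sdvd_def)
next
  fix V e' assume e': "e' \<in> basis G i"
  assume sdvd: "\<forall>e\<in>basis G (Suc i). \<forall>e'\<in>basis G i.
      c (Suc i) e e' \<noteq> 0 \<longrightarrow> mono_sdvd (lab i e') (lab (Suc i) e)"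
  have "lookup (lookup V e * entry G (Suc i) e e') 0 = 0" if e: "e \<in> basis G (Suc i)" for e
  proof (rule lookup_0_mult)
    have "lab (Suc i) e - lab i e' \<noteq> 0" if "c (Suc i) e e' \<noteq> 0"
    proof -
      have "mono_sdvd (lab i e') (lab (Suc i) e)" using sdvd e e' that by blast
      then show ?thesis
        using mono_dvd_diff_zero_iff[of "lab i e'" "lab (Suc i) e"] by (auto simp: mono_sdvd_def)
    qed
    then show "lookup (entry G (Suc i) e e') 0 = 0"
      by (auto simp: entry_eq[OF e e'] lookup_single when_def)
  qed
  then show "lookup (differential G (Suc i) V) e' \<in> irrelevant_ideal"
    using e' finite_basis
    by (simp add: irrelevant_ideal_iff differential_eq_matrix_diff lookup_matrix_diff lookup_sum)
qed

end

section \<open>From minimal free resolutions to frames\<close>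

abbreviation mono_deg :: "('b, 'x::finite, 'k::field) based_seq \<Rightarrow> nat \<Rightarrow> 'b \<Rightarrow> 'x mono" where
  "mono_deg F i e \<equiv> mono_of (mdeg F i e)"

lemma lookup_mono_of: "(\<And>x. a x \<ge> 0) \<Longrightarrow> int (lookup (mono_of a) x) = a x" for a :: "'x::finite \<Rightarrow> int"
  unfolding mono_of_def by (subst lookup_Abs_poly_mapping) auto

lemma homogenization_of_graded_free_seq:
  fixes F :: "('b, 'x::finite, 'k::field) based_seq"
  assumes F: "graded_free_seq F"
    and nonneg: "\<And>i e x. e \<in> basis F i \<Longrightarrow> 0 \<le> mdeg F i e x"
  shows "homogenization F (mono_deg F) (struct_coeff F)"
proof
  show "finite (basis F i)" for i using F by (simp add: graded_free_seq_def)
  show mdeg: "mdeg F i e = (\<lambda>x. int (lookup (mono_deg F i e) x))" if "e \<in> basis F i" for i e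
    using nonneg[OF that] by (simp add: lookup_mono_of)
  fix i e e' assume e: "e \<in> basis F (Suc i)" and e': "e' \<in> basis F i"
  have degree: "mono_deg F (Suc i) e = m + mono_deg F i e'"
    if m: "m \<in> keys (entry F (Suc i) e e')" for m
  proof (rule poly_mapping_eqI)
    fix x
    have "int (lookup m x) = mdeg F (Suc i) e x - mdeg F i e' x"
      using F e e' m by (simp add: graded_free_seq_def homogeneous_def)
    then have "int (lookup (mono_deg F (Suc i) e) x) = int (lookup (m + mono_deg F i e') x)"
      using fun_cong[OF mdeg[OF e], of x] fun_cong[OF mdeg[OF e'], of x] by (simp add: lookup_add)
    then show "lookup (mono_deg F (Suc i) e) x = lookup (m + mono_deg F i e') x" by linarith
  qed
  then have "m = mono_deg F (Suc i) e - mono_deg F i e'" if "m \<in> keys (entry F (Suc i) e e')" for m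
    using that by simp
  then show "entry F (Suc i) e e'
      = single (mono_deg F (Suc i) e - mono_deg F i e') (struct_coeff F (Suc i) e e')"
    by (intro poly_mapping_eqI) (auto simp: struct_coeff_def lookup_single when_def in_keys_iff)
  assume "struct_coeff F (Suc i) e e' \<noteq> 0"
  then have "mono_deg F (Suc i) e - mono_deg F i e' \<in> keys (entry F (Suc i) e e')"
    by (simp add: struct_coeff_def in_keys_iff)
  from degree[OF this] show "mono_dvd (mono_deg F i e') (mono_deg F (Suc i) e)"
    by (metis mono_dvd_add)
qed

lemma homogeneous_constant:
  assumes a: "homogeneous a p" and p: "lookup p 0 \<noteq> 0"
  shows "a = (\<lambda>_. 0)" and "p = single 0 (lookup p 0)"
proof -
  have "0 \<in> keys p" using p by (simp add: in_keys_iff)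
  then show zero: "a = (\<lambda>_. 0)" using a unfolding homogeneous_def by fastforce
  have "m = 0" if "m \<in> keys p" for m
    using a that by (auto simp: homogeneous_def zero intro: poly_mapping_eqI)
  then show "p = single 0 (lookup p 0)"
    by (intro poly_mapping_eqI) (auto simp: lookup_single when_def in_keys_iff)
qed

context
  fixes F :: "('b, 'x::finite, 'k::field) based_seq" and M :: "('x, 'k) mpoly set"
  assumes F: "minimal_free_resolution F M"
begin

lemma resolution_graded: "graded_free_seq F"
  using F by (simp add: minimal_free_resolution_def free_resolution_def)

lemma resolution_finite_basis: "finite (basis F i)"
  using resolution_graded by (simp add: graded_free_seq_def)

lemma resolution_augmentation:
  obtains \<epsilon> where "\<forall>e\<in>basis F 0. homogeneous (mdeg F 0 e) (\<epsilon> e)"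
    "augmentation F M \<epsilon> ` free_mod F 0 = quot UNIV M"
    "{v \<in> free_mod F 0. augmentation F M \<epsilon> v = M} = boundaries F 0"
  using F unfolding minimal_free_resolution_def free_resolution_def One_nat_def by (elim conjE exE)

lemma resolution_exact: "kernel F (Suc i) = boundaries F (Suc i)"
  using F by (simp add: minimal_free_resolution_def free_resolution_def)

lemma resolution_minimal:
  assumes "V \<in> boundaries F i" "e \<in> basis F i"
  shows "lookup (lookup V e) 0 = 0"
  using F assms by (auto simp: minimal_free_resolution_def irrelevant_ideal_iff)

lemma resolution_entry_nonzero:
  assumes e: "e \<in> basis F (Suc i)"
  shows "\<exists>e'\<in>basis F i. entry F (Suc i) e e' \<noteq> 0"
proof (rule ccontr)
  assume "\<not> ?thesis"
  then have "differential F (Suc i) (single e 1) = 0"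
    using e resolution_finite_basis
    by (intro poly_mapping_eqI) (simp add: differential_eq_matrix_diff lookup_matrix_diff_single)
  then have "single e 1 \<in> boundaries F (Suc i)"
    using e resolution_exact[of i] by (auto simp: free_mod_def)
  from resolution_minimal[OF this e] show False by simp
qed

lemma resolution_of_unit_ideal:
  assumes "M = UNIV"
  shows "basis F i = {}"
proof (induction i)
  case 0
  obtain \<epsilon> where "{v \<in> free_mod F 0. augmentation F M \<epsilon> v = M} = boundaries F 0"
    by (rule resolution_augmentation)
  moreover have "augmentation F M \<epsilon> v = M" for v
    by (simp add: augmentation_def assms)
  ultimately have im: "free_mod F 0 = boundaries F 0" by simp
  have "single e 1 \<in> free_mod F 0" if "e \<in> basis F 0" for e using that by (simp add: free_mod_def)
  then show ?case using resolution_minimal[of "single _ 1" 0] im by fastforce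
next
  case (Suc i)
  then show ?case using resolution_entry_nonzero[of _ i] by blast
qed

end

lemma augmentation_eq_ideal_iff:
  fixes M :: "('x, 'k::field) mpoly set"
  assumes "monomial_ideal M"
  shows "augmentation F M \<epsilon> v = M \<longleftrightarrow> (\<Sum>e\<in>basis F 0. lookup v e * \<epsilon> e) \<in> M"
  by (simp add: augmentation_def coset_monomial_ideal_eq_iff[OF assms])

lemma augmentation_hits_unit:
  fixes M :: "('x::finite, 'k::field) mpoly set"
  assumes M: "monomial_ideal M" "M \<noteq> UNIV"
    and surj: "augmentation F M \<epsilon> ` free_mod F 0 = quot UNIV M"
  shows "\<exists>e\<in>basis F 0. lookup (\<epsilon> e) 0 \<noteq> 0"
proof -
  have "coset M 1 \<in> quot UNIV M" by (simp add: quot_def)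
  then obtain v where v: "coset M (\<Sum>e\<in>basis F 0. lookup v e * \<epsilon> e) = coset M 1"
    unfolding surj[symmetric] augmentation_def by (elim imageE) (rule that, simp)
  have "0 \<in> M" using subspace_monomial_ideal[OF M(1)] by (rule mpoly_module.subspace_0)
  then have "1 \<in> coset M 1" unfolding coset_def by force
  then obtain b where b: "b \<in> M" "1 = (\<Sum>e\<in>basis F 0. lookup v e * \<epsilon> e) + b"
    using v unfolding coset_def by blast
  have "lookup b 0 = 0"
    using b(1) monomial_ideal_iff[OF M(1), of b] monomial_ideal_one_iff[OF M(1)] M(2)
    by (metis in_keys_iff)
  then have "(\<Sum>e\<in>basis F 0. lookup (lookup v e * \<epsilon> e) 0) = 1"
    using arg_cong[OF b(2), of "\<lambda>p. lookup p 0"] by (simp add: lookup_add lookup_sum)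
  then have "(\<Sum>e\<in>basis F 0. lookup (lookup v e * \<epsilon> e) 0) \<noteq> 0" by simp
  then obtain e where "e \<in> basis F 0" "lookup (lookup v e * \<epsilon> e) 0 \<noteq> 0"
    by (rule sum.not_neutral_contains_not_neutral)
  then show ?thesis using lookup_0_mult by blast
qed

text \<open>
  A second generator \<open>e1\<close> would be redundant: \<open>e1 - (\<epsilon> e1 / k) e0\<close> is in the kernel of the
  augmentation, which by minimality has no element with a unit coordinate.
\<close>

lemma basis_0_singleton:
  fixes F :: "('b, 'x::finite, 'k::field) based_seq"
  assumes F: "minimal_free_resolution F M" and M: "monomial_ideal M"
    and e0: "e0 \<in> basis F 0" "\<epsilon> e0 = single 0 k" "k \<noteq> 0"
    and ker: "{v \<in> free_mod F 0. augmentation F M \<epsilon> v = M} = boundaries F 0"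
  shows "basis F 0 = {e0}"
proof (rule ccontr)
  assume "basis F 0 \<noteq> {e0}"
  then obtain e1 where e1: "e1 \<in> basis F 0" "e1 \<noteq> e0" using e0(1) by blast
  define V where "V = single e1 1 - single e0 (\<epsilon> e1 * single 0 (inverse k))"
  have lookup_V: "lookup V e0 = - (\<epsilon> e1 * single 0 (inverse k))" "lookup V e1 = 1"
      "e \<noteq> e0 \<Longrightarrow> e \<noteq> e1 \<Longrightarrow> lookup V e = 0" for e
    using e1(2) by (simp_all add: V_def lookup_minus lookup_single when_def)
  have "(\<Sum>e\<in>basis F 0. lookup V e * \<epsilon> e) = (\<Sum>e\<in>{e0, e1}. lookup V e * \<epsilon> e)"
    using resolution_finite_basis[OF F] e0(1) e1(1) lookup_V(3)
    by (intro sum.mono_neutral_right) auto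
  also have "\<dots> = lookup V e0 * \<epsilon> e0 + lookup V e1 * \<epsilon> e1" using e1(2) by simp
  also have "\<dots> = \<epsilon> e1 - \<epsilon> e1 * (single 0 (inverse k) * single 0 k)"
    unfolding lookup_V e0(2)
    by (simp only: mult_minus_left mult_1_left mult.assoc uminus_add_conv_diff)
  also have "\<dots> = 0" using e0(3) by (simp add: mult_single)
  finally have "augmentation F M \<epsilon> V = M"
    using subspace_monomial_ideal[OF M]
    by (simp add: augmentation_eq_ideal_iff[OF M] mpoly_module.subspace_0)
  moreover have "V \<in> free_mod F 0"
    using lookup_V(3) e0(1) e1(1)
    unfolding free_mod_def in_keys_iff subset_iff mem_Collect_eq by metis
  ultimately have "V \<in> boundaries F 0" using ker by auto
  from resolution_minimal[OF F this e1(1)] show False by (simp add: lookup_V(2))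
qed

context
  fixes F :: "('b, 'x::finite, 'k::field) based_seq" and M :: "('x, 'k) mpoly set"
  assumes F: "minimal_free_resolution F M" and M: "monomial_ideal M" and M_proper: "M \<noteq> UNIV"
begin

lemma resolution_degree_zero:
  obtains e0 where "basis F 0 = {e0}" "mdeg F 0 e0 = (\<lambda>_. 0)"
    "{v \<in> free_mod F 0. lookup v e0 \<in> M} = boundaries F 0"
proof -
  obtain \<epsilon> where hom: "\<forall>e\<in>basis F 0. homogeneous (mdeg F 0 e) (\<epsilon> e)"
    and surj: "augmentation F M \<epsilon> ` free_mod F 0 = quot UNIV M"
    and ker: "{v \<in> free_mod F 0. augmentation F M \<epsilon> v = M} = boundaries F 0"
    using F by (rule resolution_augmentation)
  obtain e0 where e0: "e0 \<in> basis F 0" "lookup (\<epsilon> e0) 0 \<noteq> 0"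
    using augmentation_hits_unit[OF M M_proper surj] by blast
  define k where "k = lookup (\<epsilon> e0) 0"
  have k: "k \<noteq> 0" "\<epsilon> e0 = single 0 k" and mdeg: "mdeg F 0 e0 = (\<lambda>_. 0)"
    using e0(2) homogeneous_constant[OF bspec[OF hom e0(1)] e0(2)] by (simp_all add: k_def)
  have basis: "basis F 0 = {e0}" by (rule basis_0_singleton[OF F M e0(1) k(2,1) ker])
  have "p * single 0 k \<in> M \<longleftrightarrow> p \<in> M" for p
    unfolding monomial_ideal_iff[OF M, of p] monomial_ideal_iff[OF M, of "p * single 0 k"]
    using k(1) by (simp add: Ball_def in_keys_iff lookup_times_single)
  then have "augmentation F M \<epsilon> v = M \<longleftrightarrow> lookup v e0 \<in> M" for v
    by (simp add: augmentation_eq_ideal_iff[OF M] basis k(2))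
  then show thesis using that[OF basis mdeg] ker by simp
qed

lemma resolution_mdeg_nonneg: "e \<in> basis F i \<Longrightarrow> 0 \<le> mdeg F i e x"
proof (induction i arbitrary: e)
  case 0
  then show ?case using resolution_degree_zero by (metis order_refl singletonD)
next
  case (Suc i)
  obtain e' where e': "e' \<in> basis F i" "entry F (Suc i) e e' \<noteq> 0"
    using resolution_entry_nonzero[OF F Suc.prems] by blast
  then obtain m where "m \<in> keys (entry F (Suc i) e e')" by (metis keys_eq_empty ex_in_conv)
  then have "int (lookup m x) = mdeg F (Suc i) e x - mdeg F i e' x"
    using resolution_graded[OF F] Suc.prems e'(1) by (simp add: graded_free_seq_def homogeneous_def)
  then show ?case using Suc.IH[OF e'(1)] by linarith
qed

lemma homogenization_of_resolution: "homogenization F (mono_deg F) (struct_coeff F)"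
  using resolution_graded[OF F] resolution_mdeg_nonneg by (rule homogenization_of_graded_free_seq)

end

locale homogenized_resolution = homogenization G lab c
  for G :: "('b, 'x::finite, 'k::field) based_seq" and lab c +
  fixes M :: "('x, 'k) mpoly set" and e0 :: 'b
  assumes G: "minimal_free_resolution G M" and M: "monomial_ideal M" and M_proper: "M \<noteq> UNIV"
    and basis_0: "basis G 0 = {e0}" and lab_0: "lab 0 e0 = 0"
    and ker: "{V \<in> free_mod G 0. lookup V e0 \<in> M} = boundaries G 0"
begin

lemma label_in_ideal: "e \<in> basis G (Suc i) \<Longrightarrow> monom_poly (lab (Suc i) e) \<in> M"
proof (induction i arbitrary: e)
  case 0
  have entry: "entry G (Suc 0) e e0 = single (lab (Suc 0) e) (c (Suc 0) e e0)"
    using entry_eq[OF 0, of e0] by (simp add: basis_0 lab_0)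
  then have "c (Suc 0) e e0 \<noteq> 0"
    using resolution_entry_nonzero[OF G 0] by (auto simp: basis_0)
  moreover have "lookup (differential G (Suc 0) (single e 1)) e0 \<in> M"
    using ker 0 by (auto simp: free_mod_def)
  then have "entry G (Suc 0) e e0 \<in> M"
    using 0 finite_basis
    by (simp add: differential_eq_matrix_diff lookup_matrix_diff_single basis_0)
  ultimately show ?case by (simp add: entry monomial_ideal_single[OF M])
next
  case (Suc i)
  then obtain e' where e': "e' \<in> basis G (Suc i)" "entry G (Suc (Suc i)) e e' \<noteq> 0"
    using resolution_entry_nonzero[OF G] by blast
  then have "c (Suc (Suc i)) e e' \<noteq> 0" by (auto simp: entry_eq[OF Suc.prems e'(1)])
  then show ?case
    using Suc.IH[OF e'(1)] c_dvd[OF Suc.prems e'(1)] monomial_ideal_dvd[OF M] by blast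
qed

lemma exact_at_0:
  assumes a: "monom_poly a \<in> M"
  shows "exact_at diff (weakly_below a) 0"
  unfolding exact_at_def
proof
  fix z assume "z \<in> cycles diff (weakly_below a) 0"
  then have z: "keys z \<subseteq> weakly_below a 0" by (simp add: cycles_def)
  have "lookup (lift 0 a z) e0 = single a (lookup z e0)"
    by (simp add: lookup_lift basis_0 lab_0)
  then have "lookup (lift 0 a z) e0 \<in> M"
    using a by (subst monomial_ideal_iff[OF M]) auto
  then have "lift 0 a z \<in> boundaries G 0"
    unfolding ker[symmetric] by (simp add: lift_in_free_mod)
  then show "\<exists>w. keys w \<subseteq> weakly_below a (Suc 0) \<and> diff (Suc 0) w = z"
    unfolding mem_boundaries_iff[OF lift_in_free_mod] by (metis strand_lift[OF z])
qed

lemma resolution_frame_of_resolution: "resolution_frame (basis G) c e0 lab M"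
proof
  show "finite (basis G i)" "basis G 0 = {e0}" "lab 0 e0 = 0" "monomial_ideal M" "M \<noteq> UNIV" for i
    by (fact finite_basis basis_0 lab_0 M M_proper)+
  show "diff (Suc i) (diff (Suc (Suc i)) v) = 0" if v: "keys v \<subseteq> basis G (Suc (Suc i))" for i v
    using resolution_exact[OF G, of i] differential_differential_eq_0_iff[of i] v by blast
  show "mono_sdvd (lab i e') (lab (Suc i) e)"
    if "e \<in> basis G (Suc i)" "e' \<in> basis G i" "c (Suc i) e e' \<noteq> 0" for i e e'
    using that G differential_in_irrelevant_ideal_iff[of i]
    by (simp add: minimal_free_resolution_def)
  show "monom_poly (lab (Suc i) e) \<in> M" if "e \<in> basis G (Suc i)" for i e
    using that by (rule label_in_ideal)
  show "exact_on diff (weakly_below a)" if a: "monom_poly a \<in> M" for a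
    unfolding exact_on_def
  proof
    show "exact_at diff (weakly_below a) i" for i
    proof (cases i)
      case (Suc j)
      then show ?thesis using kernel_subset_boundaries_iff[of j] resolution_exact[OF G, of j]
        by blast
    qed (simp add: exact_at_0[OF a])
  qed
qed

end

lemma ex_resolution_frame:
  assumes F: "minimal_free_resolution F M" and M: "monomial_ideal M" "M \<noteq> UNIV"
  shows "\<exists>e0. resolution_frame (basis F) (struct_coeff F) e0 (mono_deg F) M"
proof -
  interpret homogenization F "mono_deg F" "struct_coeff F"
    by (rule homogenization_of_resolution[OF assms])
  obtain e0 where "basis F 0 = {e0}" "mdeg F 0 e0 = (\<lambda>_. 0)"
      "{v \<in> free_mod F 0. lookup v e0 \<in> M} = boundaries F 0"
    by (rule resolution_degree_zero[OF assms])
  then have "homogenized_resolution F (mono_deg F) (struct_coeff F) M e0"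
    using F M by unfold_locales (simp_all add: mono_of_def)
  then show ?thesis by (intro exI) (rule homogenized_resolution.resolution_frame_of_resolution)
qed

section \<open>From frames to minimal free resolutions\<close>

locale homogenized_resolution_frame =
  homogenization G lab c +
  frame: resolution_frame "basis G" c e0 lab M
  for G :: "('b, 'x::finite, 'k::field) based_seq" and lab c e0 and M :: "('x, 'k) mpoly set"
begin

lemma weakly_below_empty: "monom_poly a \<notin> M \<Longrightarrow> weakly_below a (Suc i) = {}"
  using frame.lab_in_ideal monomial_ideal_dvd[OF frame.M] by (auto simp: below_def)

lemma exact_at_Suc: "exact_at diff (weakly_below a) (Suc i)"
proof (cases "monom_poly a \<in> M")
  case True
  then show ?thesis using frame.exact by (simp add: exact_on_def)
next
  case False
  then have "z = 0" if "z \<in> cycles diff (weakly_below a) (Suc i)" for z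
    using that by (simp add: cycles_def weakly_below_empty)
  then show ?thesis
    unfolding exact_at_def by (metis empty_subsetI keys_zero linear_map_zero linear_map_matrix_diff)
qed

lemma kernel_eq_boundaries: "kernel G (Suc i) = boundaries G (Suc i)"
proof
  show "kernel G (Suc i) \<subseteq> boundaries G (Suc i)"
    using exact_at_Suc by (simp add: kernel_subset_boundaries_iff)
  have "\<forall>V\<in>free_mod G (Suc (Suc i)). differential G (Suc i) (differential G (Suc (Suc i)) V) = 0"
    using frame.diff_diff differential_differential_eq_0_iff by blast
  then show "boundaries G (Suc i) \<subseteq> kernel G (Suc i)"
    using differential_in_free_mod by blast
qed

lemma mem_boundaries_0_iff:
  assumes V: "V \<in> free_mod G 0"
  shows "V \<in> boundaries G 0 \<longleftrightarrow> lookup V e0 \<in> M"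
proof -
  have strand: "strand 0 a V = single e0 (lookup (lookup V e0) a)" for a
    by (rule poly_mapping_eqI)
      (auto simp: lookup_strand below_def frame.B_0 frame.lab_0 lookup_single when_def)
  have "(\<exists>w. keys w \<subseteq> weakly_below a (Suc 0) \<and> diff (Suc 0) w = strand 0 a V)
      \<longleftrightarrow> (lookup (lookup V e0) a \<noteq> 0 \<longrightarrow> monom_poly a \<in> M)" for a
  proof (cases "monom_poly a \<in> M")
    case True
    have "strand 0 a V \<in> cycles diff (weakly_below a) 0" using keys_strand by (simp add: cycles_def)
    then show ?thesis using frame.exact[OF True] True unfolding exact_on_def exact_at_def by blast
  next
    case False
    have "(\<exists>w. keys w \<subseteq> weakly_below a (Suc 0) \<and> diff (Suc 0) w = strand 0 a V) \<longleftrightarrow> strand 0 a V = 0"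
      by (auto simp: weakly_below_empty[OF False] linear_map_zero[OF linear_map_matrix_diff])
    also have "\<dots> \<longleftrightarrow> lookup (lookup V e0) a = 0"
      unfolding strand by (simp flip: keys_eq_empty)
    finally show ?thesis using False by simp
  qed
  then show ?thesis
    unfolding mem_boundaries_iff[OF V]
    by (subst monomial_ideal_iff[OF frame.M]) (auto simp: in_keys_iff)
qed

lemma free_resolution: "free_resolution G M"
  unfolding free_resolution_def
proof (intro conjI allI exI[of _ "\<lambda>_. 1"])
  have aug: "augmentation G M (\<lambda>_. 1) V = coset M (lookup V e0)" for V
    by (simp add: augmentation_def frame.B_0)
  show "graded_free_seq G" by (rule graded_free_seq)
  show "\<forall>e\<in>basis G 0. homogeneous (mdeg G 0 e) (1 :: ('x, 'k) mpoly)"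
    using mdeg_eq[of e0 0] by (simp add: frame.B_0 homogeneous_def frame.lab_0)
  have "coset M p \<in> augmentation G M (\<lambda>_. 1) ` free_mod G 0" for p
    by (rule image_eqI[of _ _ "single e0 p"]) (simp_all add: aug free_mod_def frame.B_0)
  then show "augmentation G M (\<lambda>_. 1) ` free_mod G 0 = quot UNIV M"
    by (auto simp: aug quot_def)
  show "{V \<in> free_mod G 0. augmentation G M (\<lambda>_. 1) V = M} = differential G 1 ` free_mod G 1"
    using mem_boundaries_0_iff differential_in_free_mod
    by (auto simp: aug coset_monomial_ideal_eq_iff[OF frame.M])
qed (rule kernel_eq_boundaries)

lemma minimal_free_resolution: "minimal_free_resolution G M"
  unfolding minimal_free_resolution_def
  using free_resolution differential_in_irrelevant_ideal_iff frame.lab_sdvd by blast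

end

section \<open>Relabeling\<close>

lemma minimal_free_resolution_relabel:
  fixes F :: "('b, 'x::finite, 'k::field) based_seq"
  assumes "resolution_frame (basis F) (struct_coeff F) e0 (\<lambda>i e. g (mono_deg F i e)) N"
  shows "minimal_free_resolution (relabel g F) N"
proof -
  let ?lab = "\<lambda>i e. g (mono_deg F i e)"
  interpret frame: resolution_frame "basis F" "struct_coeff F" e0 ?lab N by fact
  have "homogenization (relabel g F) ?lab (struct_coeff F)"
    using frame.finite_B frame.lab_sdvd by unfold_locales (simp_all add: relabel_def mono_sdvd_def)
  moreover have "resolution_frame (basis (relabel g F)) (struct_coeff F) e0 ?lab N"
    using frame.resolution_frame_axioms by (simp add: relabel_def)
  ultimately have "homogenized_resolution_frame (relabel g F) ?lab (struct_coeff F) e0 N"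
    by (rule homogenized_resolution_frame.intro)
  then show ?thesis by (rule homogenized_resolution_frame.minimal_free_resolution)
qed

lemma minimal_free_resolution_unit_ideal:
  assumes "\<And>i. basis G i = {}"
  shows "minimal_free_resolution G UNIV"
  using assms
  by (auto simp: minimal_free_resolution_def free_resolution_def graded_free_seq_def free_mod_def
      differential_def augmentation_def quot_def)

theorem theorem2p1:
  fixes M :: "('x::finite, 'k::field) mpoly set"
    and N :: "('y::finite, 'k) mpoly set"
    and g :: "'x mono \<Rightarrow> 'y mono"
    and F :: "('b, 'x, 'k) based_seq"
  assumes "monomial_ideal M" and "monomial_ideal N"
    and "M = UNIV \<longleftrightarrow> N = UNIV"
    and "poset_iso mono_dvd (betti_poset M) mono_dvd (betti_poset N) g"
    and "minimal_free_resolution F M"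
  shows "minimal_free_resolution (relabel g F) N"
proof (cases "M = UNIV")
  case True
  then have "basis (relabel g F) i = {}" for i
    using resolution_of_unit_ideal[OF assms(5)] by (simp add: relabel_def)
  then show ?thesis using True assms(3) minimal_free_resolution_unit_ideal by blast
next
  case False
  then have "N \<noteq> UNIV" using assms(3) by simp
  obtain e0 where "resolution_frame (basis F) (struct_coeff F) e0 (mono_deg F) M"
    using ex_resolution_frame[OF assms(5,1) False] by blast
  then have "resolution_frame (basis F) (struct_coeff F) e0 (\<lambda>i e. g (mono_deg F i e)) N"
    using assms(2) \<open>N \<noteq> UNIV\<close> assms(4) by (rule resolution_frame.resolution_frame_relabel)
  then show ?thesis by (rule minimal_free_resolution_relabel)
qed

end
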